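(* Let $\tilde L(x;b,\tilde\xi)$ and $\tilde\beta=\tilde\beta(b,\tilde\xi)$ be as defined in the context, for $x\in[-\frac12,\frac12]$. Then: (a) For fixed $b\ge1$ and $\tilde\xi\ge1$ (with $(b,\tilde\xi)\neq(1,1)$), the function $x\mapsto\tilde L(x;b,\tilde\xi)$ is constant on $[-\tilde\beta,\tilde\beta]$, strictly increasing on $[\tilde\beta,\frac12]$, and decreasing on $[-\frac12,-\tilde\beta]$. (b) For fixed $b>1$, $\tilde L(\pm\frac12;b,\tilde\xi)$ is a decreasing function of $\tilde\xi>1$. The same is true for $x$ in a neighborhood of the endpoints $\pm\frac12$, where the size of the neighborhood may depend on $\tilde\xi$: for every $\tilde\xi_0>1$ there is $\delta>0$ such that for each $x$ with $\frac12-\delta<|x|\le\frac12$ the function $\tilde\xi\mapsto\tilde L(x;b,\tilde\xi)$ is decreasing in a neighborhood of $\tilde\xi_0$. (c) Fix $b>1$. For fixed $x\in[-\tilde\beta,\tilde\beta]$, $\tilde L(x;b,\tilde\xi)$ is an increasing function of $\tilde\xi$ (on the range of $\tilde\xi$ for which $|x|\le\tilde\beta(b,\tilde\xi)$). As $\tilde\xi\to\infty$, $\tilde\beta$ converges to $\frac12$ and $\tilde L(x;b,\tilde\xi)$ (for such $x$) approaches a strictly negative constant. (d) For any $b>2$, $\tilde L(x;b,\tilde\xi)<0$ for all $\tilde\xi\ge1$ and all $x\in[-\frac12,\frac12]$. (e) For any $1<b\le2$ there exists $\tilde\xi_b$ such that for every $\tilde\xi>\tilde\xi_b$ the function $\tilde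 L(x;b,\tilde\xi)$ is negative for all $x\in[-\frac12,\frac12]$; conversely, for each $1\le\tilde\xi<\tilde\xi_b$ there exists $x_{\tilde\xi}\in(0,\frac12)$ such that $\tilde L(x;b,\tilde\xi)$ is positive for all $x\in[-\frac12,-x_{\tilde\xi})\cup(x_{\tilde\xi},\frac12]$.
   Context: For $\alpha\in(0,\pi]$ and $\xi\ge\pi/\alpha$ (with $(\alpha,\xi)\ne(\pi,1)$), let $\beta\in[0,\alpha]$ be defined by $\cos\beta=\cos\alpha+(1+\cos\alpha)\tan^2\!\left(\frac{\pi}{2\xi}\right)$, and define a probability density on $[-\alpha,\alpha]$ by $$\rho(\theta)=\frac{\xi}{\pi^2}\arctan\!\left(\frac{\sqrt2\,\tan\left(\frac{\pi}{2\xi}\right)\cos(\theta/2)}{\sqrt{\cos\theta-\cos\beta}}\right)\ \ (|\theta|<\beta),\qquad \rho(\theta)=\frac{\xi}{2\pi}\ \ (\beta\le|\theta|\le\alpha).$$ Set $$L(\phi;\alpha,\xi)=\int_{-\alpha}^{\alpha}\log|e^{i\phi}-e^{i\theta}|\,\rho(\theta)\,d\theta,\qquad \phi\in[-\alpha,\alpha].$$ For $b\ge1$, $\tilde\xi\ge1$, define $\tilde L(x;b,\tilde\xi)=L(2\pi x/b;\,\pi/b,\,b\tilde\xi)$ for $x\in[-\frac12,\frac12]$, and $\tilde\beta=\frac{b\beta}{2\pi}$ with $\alpha=\pi/b$, $\xi=b\tilde\xi$; equivalently, $\tilde\beta\in[0,\frac12]$ and $\cos\frac{2\pi\tilde\beta}{b}=\cos(\pi/b)+(1+\cos(\pi/b))\tan^2\!\left(\frac{\pi}{2b\tilde\xi}\right)$.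 *)

theory Defs
  imports "HOL-Analysis.Analysis"
begin

definition beta :: "real \<Rightarrow> real \<Rightarrow> real" where
  "beta \<alpha> \<xi> = arccos (cos \<alpha> + (1 + cos \<alpha>) * (tan (pi / (2 * \<xi>)))\<^sup>2)"

(* On the admissible parameter range beta is the unique angle in [0,alpha] with the required
   cosine. The pair (pi,1) has to be left out because tan (pi/2) is singular there. *)
lemma beta_characterization:
  assumes "0 < \<alpha>" "\<alpha> \<le> pi" "pi / \<alpha> \<le> \<xi>" "(\<alpha>, \<xi>) \<noteq> (pi, 1)"
  shows "\<beta> = beta \<alpha> \<xi> \<longleftrightarrow>
    \<beta> \<in> {0..\<alpha>} \<and> cos \<beta> = cos \<alpha> + (1 + cos \<alpha>) * (tan (pi / (2 * \<xi>)))\<^sup>2"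
proof -
  define t where "t = (tan (pi / (2 * \<xi>)))\<^sup>2"
  define c where "c = cos \<alpha> + (1 + cos \<alpha>) * t"
  have \<xi>: "0 < \<xi>" using assms(1,3) by (metis divide_pos_pos less_le_trans pi_gt_zero)
  have nn: "0 \<le> 1 + cos \<alpha>" using cos_ge_minus_one[of \<alpha>] by linarith
  have lo: "cos \<alpha> \<le> c"
    using mult_nonneg_nonneg[OF nn, of t] unfolding c_def t_def by simp
  have hi: "c \<le> 1"
  proof (cases "\<alpha> = pi")
    case True
    then show ?thesis by (simp add: c_def)
  next
    case False
    then have lt: "\<alpha> / 2 < pi / 2" using assms(2) by simp
    have pos: "0 < pi / (2 * \<xi>)" using \<xi> by simp
    have le: "pi / (2 * \<xi>) \<le> \<alpha> / 2" using assms(1,3) \<xi> by (simp add: field_simps)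
    have "tan (pi / (2 * \<xi>)) \<le> tan (\<alpha> / 2)"
      using lt pos le by (intro tan_mono_le) linarith+
    moreover have "0 \<le> tan (pi / (2 * \<xi>))"
      using lt pos le by (intro less_imp_le tan_gt_zero) linarith+
    ultimately have "t \<le> (tan (\<alpha> / 2))\<^sup>2"
      unfolding t_def by (rule power_mono)
    then have "c \<le> cos \<alpha> + (1 + cos \<alpha>) * (tan (\<alpha> / 2))\<^sup>2"
      unfolding c_def using nn by (intro add_left_mono mult_left_mono)
    also have "\<dots> = 1"
    proof -
      have "cos (\<alpha> / 2) > 0" using lt assms(1) by (intro cos_gt_zero) auto
      moreover have "cos \<alpha> = 2 * (cos (\<alpha> / 2))\<^sup>2 - 1"
        using cos_double_cos[of "\<alpha> / 2"] by simp
      ultimately show ?thesis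
        by (simp add: tan_def power_divide sin_squared_eq)
    qed
    finally show ?thesis .
  qed
  have m1: "-1 \<le> c" using lo nn by linarith
  have "arccos c \<le> arccos (cos \<alpha>)"
    using lo hi nn by (intro arccos_le_arccos) linarith+
  then have in_range: "arccos c \<in> {0..\<alpha>}"
    using assms(1,2) arccos_lbound[OF m1 hi] by (simp add: arccos_cos)
  have "\<beta> = arccos c \<longleftrightarrow> \<beta> \<in> {0..\<alpha>} \<and> cos \<beta> = c"
  proof
    assume "\<beta> = arccos c"
    then show "\<beta> \<in> {0..\<alpha>} \<and> cos \<beta> = c" using in_range cos_arccos[OF m1 hi] by simp
  next
    assume "\<beta> \<in> {0..\<alpha>} \<and> cos \<beta> = c"
    then show "\<beta> = arccos c" using assms(2) arccos_cos[of \<beta>] by auto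
  qed
  then show ?thesis by (simp add: beta_def c_def t_def)
qed

definition rho :: "real \<Rightarrow> real \<Rightarrow> real \<Rightarrow> real" where
  "rho \<alpha> \<xi> \<theta> =
    (if \<bar>\<theta>\<bar> < beta \<alpha> \<xi> then
       \<xi> / pi\<^sup>2 * arctan (sqrt 2 * tan (pi / (2 * \<xi>)) * cos (\<theta> / 2) / sqrt (cos \<theta> - cos (beta \<alpha> \<xi>)))
     else \<xi> / (2 * pi))"

(* The singularity at theta = phi, where Isabelle sets ln 0 = 0, is a null set. *)
definition L :: "real \<Rightarrow> real \<Rightarrow> real \<Rightarrow> real" where
  "L \<phi> \<alpha> \<xi> = (LINT \<theta>:{-\<alpha>..\<alpha>}|lborel. ln (norm (cis \<phi> - cis \<theta>)) * rho \<alpha> \<xi> \<theta>)"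

definition L_tilde :: "real \<Rightarrow> real \<Rightarrow> real \<Rightarrow> real" where
  "L_tilde x b \<xi> = L (2 * pi * x / b) (pi / b) (b * \<xi>)"

definition beta_tilde :: "real \<Rightarrow> real \<Rightarrow> real" where
  "beta_tilde b \<xi> = b * beta (pi / b) (b * \<xi>) / (2 * pi)"

end

theory Submission
  imports Defs "HOL-Real_Asymp.Real_Asymp"
begin

text \<open>The density \<open>rho\<close> is the solution of a constrained equilibrium problem on the arc
\<open>|\<theta>| \<le> \<alpha>\<close>, and such measures are averages of unconstrained equilibrium measures of smaller arcs.
Put \<open>a(u)\<^sup>2 = 1 - cos\<^sup>2 (\<alpha> / 2) / cos\<^sup>2 (pi u / 2)\<close>, which is nonincreasing in \<open>u \<ge> 0\<close>,
starts at \<open>sin\<^sup>2 (\<alpha> / 2)\<close> and satisfies \<open>a(1 / \<xi>) = sin (\<beta> / 2)\<close>.  If \<open>\<omega>\<^sub>a\<close> is the equilibrium measure of the arc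
\<open>|sin (\<theta> / 2)| \<le> a\<close>, integrating its explicit density in \<open>u\<close> gives an arcsine, and
\<open>rho = \<xi> \<integral>\<^sub>0 \<omega>\<^sub>a\<^sub>(\<^sub>u\<^sub>) du\<close> with upper limit \<open>1 / \<xi>\<close> (lemma \<open>nn_integral_mixture\<close>).  By Tonelli's theorem
\<open>L\<close> is then the average over \<open>u \<in> [0, 1 / \<xi>]\<close> of the potentials of these equilibrium measures
(lemma \<open>has_integral_L\<close>).

With \<open>y = sin (\<phi> / 2)\<close> the potential of \<open>\<omega>\<^sub>a\<close> is \<open>ln a\<close> for \<open>|y| \<le> a\<close> and
\<open>ln (|y| + sqrt (y\<^sup>2 - a\<^sup>2))\<close> otherwise (lemma \<open>nn_integral_log_kernel_arc_density\<close>).  The substitution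
\<open>sin (\<theta> / 2) = a sin t\<close> reduces this to the integral of \<open>ln |y\<^sup>2 - a\<^sup>2 sin\<^sup>2 t|\<close>, and that to the
integral of \<open>ln |sin|\<close> over a period, respectively to the mean of \<open>ln |1 - q exp (i x)|\<close> over the circle.

Every claim follows from this representation.  The equilibrium potential is nondecreasing in \<open>|y|\<close>,
strictly so off the arc, and constant on it: this is the behaviour in \<open>x\<close>.  For fixed \<open>y\<close> it
decreases in \<open>u\<close> as long as the arc contains the point and increases afterwards, and the
average over \<open>[0, s]\<close> increases with \<open>s\<close> where it lies below the integrand, decreases where it lies above:
this is the behaviour in \<open>\<xi>\<close> inside the arc, and at and near the endpoint.  For \<open>\<xi> \<rightarrow> \<infinity>\<close> the
average tends to the value \<open>ln (sin (\<alpha> / 2)) < 0\<close> of the integrand at \<open>u = 0\<close>.  The maximum over \<open>x\<close> is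
taken at the endpoint, where it decreases in \<open>\<xi>\<close>; so the sign for \<open>b > 2\<close> is decided at \<open>\<xi> = 1\<close>, where pairing
\<open>u\<close> with \<open>1 / b - u\<close> shows it to be negative (lemma \<open>L_tilde_uniform_negative\<close>), and for \<open>b \<le> 2\<close> there
is a threshold.\<close>

section \<open>The logarithmic sine integral\<close>

lemma half_le_sin:
  assumes "0 \<le> t" "t \<le> pi / 2"
  shows "t / 2 \<le> sin (t::real)"
proof -
  have xcos: "x * cos x \<le> sin x" if "0 \<le> x" "x \<le> pi" for x :: real
  proof -
    have "sin 0 - 0 * cos 0 \<le> sin x - x * cos (x::real)"
    proof (rule DERIV_nonneg_imp_nondecreasing[OF that(1)])
      fix z :: real assume "0 \<le> z" "z \<le> x"
      then have "0 \<le> z * sin z" using that(2) by (intro mult_nonneg_nonneg sin_ge_zero) auto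
      then show "\<exists>y. ((\<lambda>x. sin x - x * cos x) has_real_derivative y) (at z) \<and> 0 \<le> y"
        by (intro exI[of _ "z * sin z"]) (auto intro!: derivative_eq_intros)
    qed
    then show ?thesis by simp
  qed
  have h: "0 \<le> t / 2" "t / 2 \<le> pi / 4" using assms by auto
  have c: "cos (pi / 4) \<le> cos (t / 2)" using h by (intro cos_monotone_0_pi_le) auto
  have c0: "0 \<le> cos (t / 2)" using c by (simp add: cos_45 order_trans[of 0 "sqrt 2 / 2"])
  have "(sqrt 2 / 2) * (sqrt 2 / 2) \<le> cos (t / 2) * cos (t / 2)"
    using c c0 by (intro mult_mono) (auto simp: cos_45)
  then have "1 / 2 \<le> cos (t / 2) * cos (t / 2)" by simp
  then have "t / 2 \<le> t * (cos (t / 2) * cos (t / 2))"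
    using mult_left_mono[of "1/2" "cos (t / 2) * cos (t / 2)" t] assms(1) by simp
  also have "\<dots> = 2 * (t / 2 * cos (t / 2)) * cos (t / 2)" by simp
  also have "\<dots> \<le> 2 * sin (t / 2) * cos (t / 2)"
    using xcos[of "t / 2"] h c0 by (intro mult_right_mono mult_left_mono) auto
  also have "\<dots> = sin t" using sin_double[of "t / 2"] by simp
  finally show ?thesis .
qed

lemma integrable_ln_sin: "(\<lambda>t. ln (sin t)) integrable_on {0..pi / 2}"
proof (rule measurable_bounded_by_integrable_imp_integrable)
  show "(\<lambda>t. ln (sin t)) \<in> borel_measurable (lebesgue_on {0..pi / 2})"
    by (intro measurable_restrict_space1 measurable_completion) simp
  define F where "F = (\<lambda>t::real. t - t * ln (t / 2))"
  show "(\<lambda>t. - ln (t / 2)) integrable_on {0..pi / 2}"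
  proof -
    have "((\<lambda>t. - ln (t / 2)) has_integral F (pi / 2) - F 0) {0..pi / 2}"
    proof (rule fundamental_theorem_of_calculus_interior)
      show "continuous_on {0..pi / 2} F"
        unfolding continuous_on_eq_continuous_within
      proof
        fix x :: real assume x: "x \<in> {0..pi / 2}"
        show "continuous (at x within {0..pi / 2}) F"
        proof (cases "x = 0")
          case True
          have "((\<lambda>t::real. t - t * ln (t / 2)) \<longlongrightarrow> 0) (at_right 0)"
            by real_asymp
          moreover have "at (0::real) within {0..pi / 2} \<le> at_right 0"
            by (simp add: at_within_Icc_at_right)
          ultimately show ?thesis
            using True by (simp add: continuous_within F_def at_within_Icc_at_right)
        next
          case False
          then show ?thesis using x unfolding F_def by (intro continuous_intros) auto
        qed
      qed
      fix x assume "x \<in> {0<..<pi / 2}"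
      then show "(F has_vector_derivative - ln (x / 2)) (at x)"
        unfolding F_def has_real_derivative_iff_has_vector_derivative[symmetric]
        by (auto intro!: derivative_eq_intros)
    qed auto
    then show ?thesis by blast
  qed
  show "norm (ln (sin t)) \<le> - ln (t / 2)" if "t \<in> {0..pi / 2}" for t
  proof (cases "t = 0")
    case False
    then have "ln (t / 2) \<le> ln (sin t)" using half_le_sin[of t] that by (intro ln_mono) auto
    moreover have "ln (sin t) \<le> 0"
      using half_le_sin[of t] that False by (subst ln_le_zero_iff) auto
    ultimately show ?thesis by simp
  qed simp
qed auto

text \<open>The period integral of \<open>ln |sin|\<close>.  The value over one period comes from the duplication
formula \<open>2 sin t cos t = sin (2 t)\<close>: with \<open>J\<close> the integral of \<open>ln (2 sin t)\<close> over a quarter period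
it yields \<open>J = J + J\<close>.\<close>

lemma has_integral_ln_sin_quarter: "((\<lambda>t. ln (sin t)) has_integral - (pi / 2) * ln 2) {0..pi / 2}"
proof -
  define I where "I = integral {0..pi / 2} (\<lambda>t. ln (sin t))"
  have I: "((\<lambda>t. ln (sin t)) has_integral I) {0..pi / 2}"
    using integrable_ln_sin by (simp add: I_def integrable_integral)
  have refl: "((\<lambda>t. ln (sin (- t))) has_integral I) {- (pi / 2)..- 0}"
    using I by (subst has_integral_reflect_real)
  have cos: "((\<lambda>t. ln (cos t)) has_integral I) {0..pi / 2}"
    using has_integral_shift_real_ivl[OF refl, of "- (pi / 2)"] by (simp add: sin_diff)
  have "((\<lambda>t. ln (sin (- t))) has_integral I) {pi / 2 - pi..pi - pi}"
    using refl by simp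
  from has_integral_shift_real_ivl[OF this, of "- pi"]
  have upper: "((\<lambda>t. ln (sin t)) has_integral I) {pi / 2..pi}" by (simp add: sin_diff)
  have "((\<lambda>t. ln (sin t)) has_integral I + I) {0..pi}"
    by (rule has_integral_combine[OF _ _ I upper]) auto
  from has_integral_stretch_real[OF this, of 2]
  have dbl: "((\<lambda>t. ln (sin (2 * t))) has_integral I) {0..pi / 2}"
    by (simp add: field_simps)
  have "((\<lambda>t. ln 2 + ln (sin t) + ln (cos t)) has_integral pi / 2 * ln 2 + I + I) {0..pi / 2}"
    using has_integral_const_real[of "ln 2 :: real" 0 "pi / 2"] by (intro has_integral_add I cos) simp
  then have "((\<lambda>t. ln (sin (2 * t))) has_integral pi / 2 * ln 2 + I + I) {0..pi / 2}"
  proof (rule has_integral_spike_finite[where S = "{0, pi / 2}", rotated 2])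
    fix t assume "t \<in> {0..pi / 2} - {0, pi / 2}"
    then have "0 < sin t" "0 < cos t" by (auto intro!: sin_gt_zero cos_gt_zero)
    then show "ln (sin (2 * t)) = ln 2 + ln (sin t) + ln (cos t)"
      by (simp add: sin_double ln_mult)
  qed simp
  with dbl have "I = pi / 2 * ln 2 + I + I" by (rule has_integral_unique)
  then have "I = - (pi / 2) * ln 2" by simp
  with I show ?thesis by simp
qed

lemma has_integral_ln_abs_sin:
  assumes "- pi / 2 \<le> c" "c \<le> pi / 2"
  shows "((\<lambda>t. ln \<bar>sin (t + c)\<bar>) has_integral - pi * ln 2) {- pi / 2..pi / 2}"
proof -
  let ?f = "\<lambda>t::real. ln \<bar>sin t\<bar>"
  have Q: "(?f has_integral - (pi / 2) * ln 2) {0..pi / 2}"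
    using has_integral_ln_sin_quarter
    by (rule has_integral_eq[rotated]) (auto simp: sin_ge_zero)
  have "((\<lambda>t. ?f (- t)) has_integral - (pi / 2) * ln 2) {- (pi / 2)..- 0}"
    using Q by (subst has_integral_reflect_real)
  then have P: "(?f has_integral - (pi / 2) * ln 2) {- (pi / 2)..0}" by simp
  have period: "(?f has_integral - pi * ln 2) {- (pi / 2)..pi / 2}"
    using has_integral_combine[OF _ _ P Q] by simp
  have int: "?f integrable_on {- (pi / 2)..pi / 2}" using period by blast
  \<comment> \<open>Moving the window to the right by \<open>d \<le> pi\<close> replaces its initial piece by a translate.\<close>
  have shift: "(?f has_integral - pi * ln 2) {- (pi / 2) + d..pi / 2 + d}" if d: "0 \<le> d" "d \<le> pi" for d
  proof -
    obtain i where i: "(?f has_integral i) {- (pi / 2)..- (pi / 2) + d}"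
      using integrable_on_subinterval[OF int, of "- (pi / 2)" "- (pi / 2) + d"] d by auto
    obtain j where j: "(?f has_integral j) {- (pi / 2) + d..pi / 2}"
      using integrable_on_subinterval[OF int, of "- (pi / 2) + d" "pi / 2"] d by auto
    have ij: "i + j = - pi * ln 2"
      using has_integral_combine[OF _ _ i j] d period by (auto intro: has_integral_unique)
    have "(?f has_integral i) {pi / 2..pi / 2 + d}"
      using has_integral_shift_real_ivl[OF i, of "- pi"] by (simp add: sin_diff algebra_simps)
    then have "(?f has_integral j + i) {- (pi / 2) + d..pi / 2 + d}"
      using d by (intro has_integral_combine[OF _ _ j]) auto
    then show ?thesis using ij by (simp add: add.commute)
  qed
  have "(?f has_integral - pi * ln 2) {- (pi / 2) + c..pi / 2 + c}"
  proof (cases "0 \<le> c")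
    case True
    then show ?thesis using assms shift[of c] by auto
  next
    case False
    then have "(?f has_integral - pi * ln 2) {- (pi / 2) + (c + pi)..pi / 2 + (c + pi)}"
      using assms by (intro shift) auto
    from has_integral_shift_real_ivl[OF this, of pi] show ?thesis
      by (simp add: algebra_simps)
  qed
  from has_integral_shift_real_ivl[OF this, of c] show ?thesis
    by (simp add: algebra_simps)
qed

section \<open>The equilibrium potential of an arc\<close>

text \<open>Let \<open>\<beta> \<in> (0, pi]\<close>, \<open>a = sin (\<beta> / 2)\<close> and \<open>y = sin (\<phi> / 2)\<close>.  The following is the integral of
\<open>ln |exp (i \<phi>) - exp (i \<theta>)|\<close> against the equilibrium measure of the arc \<open>|\<theta>| \<le> \<beta>\<close>: it is \<open>ln a\<close>
for \<open>|y| \<le> a\<close> and \<open>ln (|y| + sqrt (y\<^sup>2 - a\<^sup>2))\<close> off the arc.  The maxima put both cases into one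
formula that is visibly continuous.  At \<open>y = a = 0\<close>, where the potential is \<open>- \<infinity>\<close>, the formula has the
default value \<open>ln 0 = 0\<close>; this affects a single point of the integrals below.\<close>

definition arc_potential :: "real \<Rightarrow> real \<Rightarrow> real" where
  "arc_potential y a = ln (max \<bar>y\<bar> a + sqrt (max 0 (y\<^sup>2 - a\<^sup>2)))"

lemma arc_potential_inside:
  assumes "\<bar>y\<bar> \<le> a"
  shows "arc_potential y a = ln a"
proof -
  have "y\<^sup>2 \<le> a\<^sup>2" using assms power_mono[of "\<bar>y\<bar>" a 2] by simp
  then show ?thesis using assms by (simp add: arc_potential_def max_absorb1 max_absorb2)
qed

lemma arc_potential_outside:
  assumes "0 \<le> a" "a \<le> \<bar>y\<bar>"
  shows "arc_potential y a = ln (\<bar>y\<bar> + sqrt (y\<^sup>2 - a\<^sup>2))"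
proof -
  have "a\<^sup>2 \<le> y\<^sup>2" using assms power_mono[of a "\<bar>y\<bar>" 2] by simp
  then show ?thesis using assms by (simp add: arc_potential_def max_absorb1 max_absorb2)
qed

lemma has_integral_ln_inside:
  assumes "0 < a" "\<bar>y\<bar> \<le> a"
  shows "((\<lambda>t. ln \<bar>y\<^sup>2 - a\<^sup>2 * (sin t)\<^sup>2\<bar>) has_integral 2 * pi * (ln a - ln 2)) {- pi / 2..pi / 2}"
proof -
  have ya: "- 1 \<le> y / a" "y / a \<le> 1" using assms by (auto simp: field_simps abs_le_iff)
  \<comment> \<open>Writing \<open>y = a sin \<tau>\<close> makes the integrand a sum of two translates of \<open>ln |sin|\<close>.\<close>
  define \<tau> where "\<tau> = arcsin (y / a)"
  have \<tau>: "- pi / 2 \<le> \<tau>" "\<tau> \<le> pi / 2" and y: "y = a * sin \<tau>"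
    using arcsin_bounded[OF ya] ya assms by (auto simp: \<tau>_def)
  have "((\<lambda>t. 2 * ln a + (ln \<bar>sin (t + \<tau>)\<bar> + ln \<bar>sin (t + - \<tau>)\<bar>)) has_integral
      pi * (2 * ln a) + (- pi * ln 2 + - pi * ln 2)) {- pi / 2..pi / 2}"
    using has_integral_const_real[of "2 * ln a" "- pi / 2" "pi / 2"] \<tau>
    by (intro has_integral_add has_integral_ln_abs_sin) (auto simp: field_simps)
  then have "((\<lambda>t. 2 * ln a + (ln \<bar>sin (t + \<tau>)\<bar> + ln \<bar>sin (t + - \<tau>)\<bar>)) has_integral
      2 * pi * (ln a - ln 2)) {- pi / 2..pi / 2}"
    by (simp add: algebra_simps)
  then show ?thesis
  proof (rule has_integral_spike_finite[where S = "{\<tau>, - \<tau>, pi / 2, - pi / 2}", rotated 2])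
    fix t assume t: "t \<in> {- pi / 2..pi / 2} - {\<tau>, - \<tau>, pi / 2, - pi / 2}"
    then have "sin (t + \<tau>) \<noteq> 0" "sin (t - \<tau>) \<noteq> 0"
      using \<tau> sin_eq_0_pi[of "t + \<tau>"] sin_eq_0_pi[of "t - \<tau>"] by auto
    moreover have "y\<^sup>2 - a\<^sup>2 * (sin t)\<^sup>2 = - (a\<^sup>2 * (sin (t + \<tau>) * sin (t - \<tau>)))"
    proof -
      have "sin (t + \<tau>) * sin (t - \<tau>) = (sin t)\<^sup>2 * (cos \<tau>)\<^sup>2 - (cos t)\<^sup>2 * (sin \<tau>)\<^sup>2"
        unfolding sin_add sin_diff by (simp add: power2_eq_square algebra_simps)
      also have "\<dots> = (sin t)\<^sup>2 - (sin \<tau>)\<^sup>2"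
        by (simp add: cos_squared_eq algebra_simps)
      finally have "sin (t + \<tau>) * sin (t - \<tau>) = (sin t)\<^sup>2 - (sin \<tau>)\<^sup>2" .
      then show ?thesis unfolding y power_mult_distrib by (simp only: right_diff_distrib)
    qed
    ultimately show "ln \<bar>y\<^sup>2 - a\<^sup>2 * (sin t)\<^sup>2\<bar> = 2 * ln a + (ln \<bar>sin (t + \<tau>)\<bar> + ln \<bar>sin (t + - \<tau>)\<bar>)"
      using assms by (simp add: abs_mult ln_mult ln_realpow)
  qed simp
qed

lemma one_minus_abs_power2_le:
  "(1 - \<bar>q\<bar>)\<^sup>2 \<le> 1 + q\<^sup>2 - 2 * q * cos (x::real)"
proof -
  have "q * cos x \<le> \<bar>q\<bar> * 1"
    by (rule order_trans[OF abs_ge_self]) (unfold abs_mult, intro mult_left_mono abs_cos_le_one, simp)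
  then show ?thesis by (simp add: power2_eq_square algebra_simps)
qed

text \<open>The mean value of \<open>ln |1 - q exp (i x)|\<close> over the circle vanishes for \<open>|q| < 1\<close>.  The product of
\<open>|1 - q exp (i x)|\<close> and \<open>|1 + q exp (i x)|\<close> is \<open>|1 - q\<^sup>2 exp (2 i x)|\<close>, so that squaring \<open>q\<close> doubles the
integral; it stays bounded under iteration, hence is zero.\<close>

lemma has_integral_ln_one_minus_circle:
  assumes "\<bar>q\<bar> < 1"
  shows "((\<lambda>x. ln (1 + q\<^sup>2 - 2 * q * cos x)) has_integral 0) {0..pi}"
proof -
  define p where "p = (\<lambda>q x::real. ln (1 + q\<^sup>2 - 2 * q * cos x))"
  define F where "F = (\<lambda>q. integral {0..pi} (p q))"
  have pos: "0 < 1 + r\<^sup>2 - 2 * r * cos x" if "\<bar>r\<bar> < 1" for r x :: real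
  proof -
    have "0 < (1 - \<bar>r\<bar>)\<^sup>2" using that by simp
    then show ?thesis using one_minus_abs_power2_le[of r x] by linarith
  qed
  have F: "(p r has_integral F r) {0..pi}" if "\<bar>r\<bar> < 1" for r
    unfolding F_def p_def
    by (intro integrable_integral integrable_continuous_real continuous_intros)
       (use pos[OF that] in \<open>auto simp: less_imp_neq[symmetric]\<close>)
  have minus: "F (- r) = F r" if "\<bar>r\<bar> < 1" for r
  proof -
    have "((\<lambda>x. p r (- x)) has_integral F r) {- pi..- 0}"
      using F[OF that] by (subst has_integral_reflect_real)
    from has_integral_shift_real_ivl[OF this, of "- pi"]
    have "(p (- r) has_integral F r) {0..pi}" by (simp add: p_def cos_diff)
    then show ?thesis using F[of "- r"] that by (auto intro: has_integral_unique)
  qed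
  have double: "F (r\<^sup>2) = 2 * F r" if r: "\<bar>r\<bar> < 1" for r
  proof -
    have r2: "\<bar>r\<^sup>2\<bar> < 1" using r by (simp add: abs_square_less_1)
    have "((\<lambda>x. p (r\<^sup>2) (- x)) has_integral F (r\<^sup>2)) {- pi..- 0}"
      using F[OF r2] by (subst has_integral_reflect_real)
    from has_integral_shift_real_ivl[OF this, of "- 2 * pi"]
    have "(p (r\<^sup>2) has_integral F (r\<^sup>2)) {pi..2 * pi}" by (simp add: p_def cos_diff)
    then have "(p (r\<^sup>2) has_integral F (r\<^sup>2) + F (r\<^sup>2)) {0..2 * pi}"
      by (intro has_integral_combine[OF _ _ F[OF r2]]) auto
    from has_integral_stretch_real[OF this, of 2]
    have "((\<lambda>x. p (r\<^sup>2) (2 * x)) has_integral F (r\<^sup>2)) {0..pi}" by (simp add: field_simps)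
    moreover have "((\<lambda>x. p r x + p (- r) x) has_integral F r + F (- r)) {0..pi}"
      using r by (intro has_integral_add F) auto
    moreover have "p r x + p (- r) x = p (r\<^sup>2) (2 * x)" for x
    proof -
      have "p r x + p (- r) x = ln ((1 + r\<^sup>2 - 2 * r * cos x) * (1 + (- r)\<^sup>2 - 2 * (- r) * cos x))"
        unfolding p_def using pos[of r x] pos[of "- r" x] r by (subst ln_mult) auto
      also have "(1 + r\<^sup>2 - 2 * r * cos x) * (1 + (- r)\<^sup>2 - 2 * (- r) * cos x) = 1 + (r\<^sup>2)\<^sup>2 - 2 * r\<^sup>2 * cos (2 * x)"
        unfolding cos_double_cos by (simp add: power2_eq_square algebra_simps)
      finally show ?thesis by (simp add: p_def)
    qed
    ultimately have "F (r\<^sup>2) = F r + F (- r)" by (simp add: has_integral_unique)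
    with minus[OF r] show ?thesis by simp
  qed
  have iterate: "\<exists>r. \<bar>r\<bar> \<le> \<bar>q\<bar> \<and> F r = 2 ^ n * F q" for n
  proof (induction n)
    case (Suc n)
    then obtain r where r: "\<bar>r\<bar> \<le> \<bar>q\<bar>" "F r = 2 ^ n * F q" by blast
    have "\<bar>r\<bar> * \<bar>r\<bar> \<le> \<bar>r\<bar> * 1" using r assms by (intro mult_left_mono) auto
    then have "r\<^sup>2 \<le> \<bar>r\<bar>" by (simp add: power2_eq_square)
    then show ?case using r double[of r] assms by (intro exI[of _ "r\<^sup>2"]) auto
  qed auto
  define C where "C = 2 * (ln 2 - ln (1 - \<bar>q\<bar>))"
  have bound: "\<bar>F r\<bar> \<le> C * pi" if r: "\<bar>r\<bar> \<le> \<bar>q\<bar>" for r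
  proof -
    have "norm (F r) \<le> C * measure lborel (cbox 0 pi)"
    proof (rule has_integral_bound)
      show "0 \<le> C" using assms unfolding C_def using ln_le_zero_iff[of "1 - \<bar>q\<bar>"] by simp
      show "(p r has_integral F r) (cbox 0 pi)" using F r assms by auto
      fix x
      have "(1 - \<bar>q\<bar>)\<^sup>2 \<le> (1 - \<bar>r\<bar>)\<^sup>2" using r assms by (intro power_mono) auto
      then have lo: "(1 - \<bar>q\<bar>)\<^sup>2 \<le> 1 + r\<^sup>2 - 2 * r * cos x"
        using one_minus_abs_power2_le[of r x] by linarith
      have "1 + r\<^sup>2 - 2 * r * cos x \<le> (1 + \<bar>r\<bar>)\<^sup>2"
      proof -
        have "- (r * cos x) \<le> \<bar>r\<bar> * 1"
          by (rule order_trans[OF abs_ge_minus_self]) (unfold abs_mult, intro mult_left_mono abs_cos_le_one, simp)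
        then show ?thesis by (simp add: power2_eq_square algebra_simps)
      qed
      also have "\<dots> \<le> 2\<^sup>2" using r assms by (intro power_mono) auto
      finally have hi: "1 + r\<^sup>2 - 2 * r * cos x \<le> 2\<^sup>2" .
      have q: "0 < (1 - \<bar>q\<bar>)\<^sup>2" using assms by simp
      have "ln ((1 - \<bar>q\<bar>)\<^sup>2) \<le> p r x" "p r x \<le> ln (2\<^sup>2)"
        unfolding p_def using lo hi q pos[of r x] r assms by (simp_all del: power2_diff)
      then have "2 * ln (1 - \<bar>q\<bar>) \<le> p r x" "p r x \<le> 2 * ln 2"
        using assms ln_realpow[of "2::real" 2] ln_realpow[of "1 - \<bar>q\<bar>" 2] by simp_all
      moreover have "\<bar>z\<bar> \<le> 2 * (v - u)" if "2 * u \<le> z" "z \<le> 2 * v" "u \<le> 0" "0 \<le> v" for u v z :: real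
        using that by (simp add: abs_le_iff)
      ultimately show "norm (p r x) \<le> C" using assms by (simp add: C_def)
    qed
    then show ?thesis by simp
  qed
  have "F q = 0"
  proof (rule ccontr)
    assume nz: "F q \<noteq> 0"
    obtain n where n: "C * pi / \<bar>F q\<bar> < 2 ^ n" using real_arch_pow[of 2] by auto
    obtain r where "\<bar>r\<bar> \<le> \<bar>q\<bar>" "F r = 2 ^ n * F q" using iterate by blast
    with bound[of r] have "2 ^ n * \<bar>F q\<bar> \<le> C * pi" by (simp add: abs_mult)
    with n nz show False by (simp add: field_simps)
  qed
  with F[OF assms] show ?thesis by (simp add: p_def)
qed

lemma has_integral_ln_outside:
  assumes "0 < a" "a < \<bar>y\<bar>"
  shows "((\<lambda>t. ln \<bar>y\<^sup>2 - a\<^sup>2 * (sin t)\<^sup>2\<bar>) has_integral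
    2 * pi * (ln (\<bar>y\<bar> + sqrt (y\<^sup>2 - a\<^sup>2)) - ln 2)) {- pi / 2..pi / 2}"
proof -
  define r where "r = sqrt (y\<^sup>2 - a\<^sup>2)"
  \<comment> \<open>Chosen such that \<open>y\<^sup>2 - a\<^sup>2 sin\<^sup>2 t = |A + A' exp (2 i t)|\<^sup>2\<close> with \<open>0 < A' < A\<close>.\<close>
  define A A' where "A = (\<bar>y\<bar> + r) / 2" and "A' = (\<bar>y\<bar> - r) / 2"
  define q where "q = - (A' / A)"
  have "a\<^sup>2 < \<bar>y\<bar>\<^sup>2" using assms by (intro power_strict_mono) auto
  then have r2: "r\<^sup>2 = y\<^sup>2 - a\<^sup>2" and r0: "0 < r" by (auto simp: r_def)
  have "r\<^sup>2 < \<bar>y\<bar>\<^sup>2" using r2 assms by simp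
  then have ry: "r < \<bar>y\<bar>" by (rule power_less_imp_less_base) simp
  have A: "0 < A" "0 < A'" "A' < A" using r0 ry assms by (auto simp: A_def A'_def)
  have AA: "A * A' = a\<^sup>2 / 4"
    using r2 by (simp add: A_def A'_def power2_eq_square algebra_simps)
  have AA2: "A\<^sup>2 + A'\<^sup>2 = y\<^sup>2 - a\<^sup>2 / 2"
  proof -
    have "A\<^sup>2 + A'\<^sup>2 = (\<bar>y\<bar>\<^sup>2 + r\<^sup>2) / 2"
      by (simp add: A_def A'_def power2_eq_square algebra_simps field_simps)
    then show ?thesis using r2 by simp
  qed
  have q: "\<bar>q\<bar> < 1" using A by (auto simp: q_def field_simps)
  define P where "P = (\<lambda>x. 1 + q\<^sup>2 - 2 * q * cos x)"
  have Ppos: "0 < P x" for x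
  proof -
    have "0 < (1 - \<bar>q\<bar>)\<^sup>2" using q by simp
    then show ?thesis unfolding P_def using one_minus_abs_power2_le[of q x] by linarith
  qed
  have I: "((\<lambda>x. ln (P x)) has_integral 0) {0..pi}"
    unfolding P_def by (rule has_integral_ln_one_minus_circle[OF q])
  have "((\<lambda>x. ln (P (- x))) has_integral 0) {- pi..- 0}"
    using I by (subst has_integral_reflect_real)
  then have J: "((\<lambda>x. ln (P x)) has_integral 0) {- pi..0}" by (simp add: P_def)
  have "((\<lambda>x. ln (P x)) has_integral 0 + 0) {- pi..pi}"
    by (rule has_integral_combine[OF _ _ J I]) auto
  from has_integral_stretch_real[OF this, of 2]
  have "((\<lambda>t. ln (P (2 * t))) has_integral 0) {- pi / 2..pi / 2}" by (simp add: field_simps)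
  then have "((\<lambda>t. 2 * ln A + ln (P (2 * t))) has_integral pi * (2 * ln A) + 0) {- pi / 2..pi / 2}"
    using has_integral_const_real[of "2 * ln A" "- pi / 2" "pi / 2"] by (intro has_integral_add) simp_all
  moreover have "2 * ln A + ln (P (2 * t)) = ln \<bar>y\<^sup>2 - a\<^sup>2 * (sin t)\<^sup>2\<bar>" for t
  proof -
    have "y\<^sup>2 - a\<^sup>2 * (sin t)\<^sup>2 = A\<^sup>2 + A'\<^sup>2 + 2 * (A * A') * cos (2 * t)"
      unfolding AA AA2 cos_double_sin by (simp add: field_simps)
    also have "\<dots> = A\<^sup>2 * P (2 * t)"
      using A(1) by (simp add: P_def q_def field_simps power2_eq_square)
    finally have "\<bar>y\<^sup>2 - a\<^sup>2 * (sin t)\<^sup>2\<bar> = A\<^sup>2 * P (2 * t)" using Ppos[of "2 * t"] by (simp add: abs_mult)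
    then show ?thesis using Ppos[of "2 * t"] A(1) by (simp add: ln_mult ln_realpow)
  qed
  ultimately have "((\<lambda>t. ln \<bar>y\<^sup>2 - a\<^sup>2 * (sin t)\<^sup>2\<bar>) has_integral 2 * pi * ln A) {- pi / 2..pi / 2}"
    by (simp add: mult.commute mult.left_commute)
  moreover have "ln A = ln (\<bar>y\<bar> + sqrt (y\<^sup>2 - a\<^sup>2)) - ln 2"
    using ry r0 by (simp add: A_def r_def[symmetric] ln_div)
  ultimately show ?thesis by simp
qed

lemma has_integral_arc_potential:
  assumes "0 < a"
  shows "((\<lambda>t. ln \<bar>y\<^sup>2 - a\<^sup>2 * (sin t)\<^sup>2\<bar>) has_integral 2 * pi * (arc_potential y a - ln 2)) {- pi / 2..pi / 2}"
  using has_integral_ln_inside[OF assms, of y] has_integral_ln_outside[OF assms, of y] assms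
  by (cases "\<bar>y\<bar> \<le> a") (auto simp: arc_potential_inside arc_potential_outside)

section \<open>The equilibrium measure of an arc\<close>

lemma norm_cis_diff: "norm (cis x - cis y) = 2 * \<bar>sin ((x - y) / 2)\<bar>"
proof -
  have "(norm (cis x - cis y))\<^sup>2 = (cos x - cos y)\<^sup>2 + (sin x - sin y)\<^sup>2"
    by (simp add: cmod_power2)
  also have "\<dots> = 2 - 2 * cos (x - y)"
    using sin_cos_squared_add[of x] sin_cos_squared_add[of y]
    by (simp add: cos_diff power2_eq_square algebra_simps)
  also have "\<dots> = (2 * \<bar>sin ((x - y) / 2)\<bar>)\<^sup>2"
  proof -
    have "x - y = 2 * ((x - y) / 2)" by simp
    then have "cos (x - y) = 1 - 2 * (sin ((x - y) / 2))\<^sup>2" by (metis cos_double_sin)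
    then show ?thesis by (simp add: power_mult_distrib)
  qed
  finally show ?thesis by (rule power2_eq_imp_eq) auto
qed

text \<open>The density on \<open>[- pi, pi]\<close> of the equilibrium measure of the arc \<open>|sin (\<theta> / 2)| \<le> a\<close>.\<close>

definition arc_density :: "real \<Rightarrow> real \<Rightarrow> real" where
  "arc_density a \<theta> =
    (if (sin (\<theta> / 2))\<^sup>2 < a\<^sup>2 then cos (\<theta> / 2) / (2 * pi * sqrt (a\<^sup>2 - (sin (\<theta> / 2))\<^sup>2)) else 0)"

lemma arc_density_nonneg: "\<bar>\<theta>\<bar> \<le> pi \<Longrightarrow> 0 \<le> arc_density a \<theta>"
  by (auto simp: arc_density_def abs_le_iff intro!: divide_nonneg_nonneg cos_ge_zero)

lemma borel_measurable_arc_density [measurable]: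
  assumes [measurable]: "f \<in> borel_measurable M" "g \<in> borel_measurable M"
  shows "(\<lambda>x. arc_density (f x) (g x)) \<in> borel_measurable M"
  unfolding arc_density_def by measurable

lemma arc_density_full: "\<bar>\<theta>\<bar> < pi \<Longrightarrow> arc_density 1 \<theta> = 1 / (2 * pi)"
proof -
  assume "\<bar>\<theta>\<bar> < pi"
  then have c: "0 < cos (\<theta> / 2)" by (intro cos_gt_zero_pi) auto
  then have "(sin (\<theta> / 2))\<^sup>2 < 1" by (simp add: sin_squared_eq)
  then show ?thesis using c by (simp add: arc_density_def cos_squared_eq[symmetric])
qed

text \<open>Under \<open>sin (\<theta> / 2) = a sin t\<close> the equilibrium measure becomes the uniform measure in \<open>t\<close>.\<close>

lemma nn_integral_arc_density:
  fixes f :: "real \<Rightarrow> ennreal"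
  assumes [measurable]: "f \<in> borel_measurable borel" and a: "0 < a" "a \<le> 1"
  shows "(\<integral>\<^sup>+\<theta>. f \<theta> * ennreal (arc_density a \<theta>) * indicator {- pi..pi} \<theta> \<partial>lborel) =
    ennreal (1 / pi) * (\<integral>\<^sup>+t. f (2 * arcsin (a * sin t)) * indicator {- pi / 2..pi / 2} t \<partial>lborel)"
proof -
  have as: "\<bar>a * sin t\<bar> \<le> 1" for t
    using a mult_mono[of a 1 "\<bar>sin t\<bar>" 1] by (simp add: abs_mult)
  have as': "\<bar>a * sin t\<bar> < 1" if "a < 1" for t
  proof -
    have "a * \<bar>sin t\<bar> \<le> a * 1" using a by (intro mult_left_mono) auto
    then have "a * \<bar>sin t\<bar> < 1" using that by linarith
    then show ?thesis using a by (simp add: abs_mult)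
  qed
  have bounds: "- 1 \<le> a * sin t" "a * sin t \<le> 1" for t using as[of t] by linarith+
  \<comment> \<open>For \<open>a = 1\<close> the substitution is \<open>\<theta> = 2 t\<close>, and the formula for \<open>g'\<close> is \<open>0 / 0\<close> at the end points.\<close>
  obtain g g' where
    deriv: "\<And>t. t \<in> {- pi / 2..pi / 2} \<Longrightarrow> (g has_real_derivative g' t) (at t)" and
    cont: "continuous_on {- pi / 2..pi / 2} g'" and
    nonneg: "\<And>t. t \<in> {- pi / 2..pi / 2} \<Longrightarrow> 0 \<le> g' t" and
    g: "\<And>t. t \<in> {- pi / 2..pi / 2} \<Longrightarrow> g t = 2 * arcsin (a * sin t)" and
    g': "\<And>t. t \<in> {- pi / 2<..<pi / 2} \<Longrightarrow> g' t = 2 * a * cos t / sqrt (1 - (a * sin t)\<^sup>2)"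
  proof (cases "a < 1")
    case True
    have pos: "0 < 1 - (a * sin t)\<^sup>2" for t
      using as'[OF True, of t] by (simp add: abs_square_less_1)
    show thesis
    proof (rule that[of "\<lambda>t. 2 * arcsin (a * sin t)" "\<lambda>t. 2 * a * cos t / sqrt (1 - (a * sin t)\<^sup>2)"])
      show "((\<lambda>t. 2 * arcsin (a * sin t)) has_real_derivative 2 * a * cos t / sqrt (1 - (a * sin t)\<^sup>2)) (at t)"
        for t
        using as'[OF True, of t] pos[of t]
        by (auto intro!: derivative_eq_intros simp: field_simps abs_less_iff)
      show "continuous_on {- pi / 2..pi / 2} (\<lambda>t. 2 * a * cos t / sqrt (1 - (a * sin t)\<^sup>2))"
        using pos by (intro continuous_intros) (auto simp: less_imp_neq[symmetric])
      show "0 \<le> 2 * a * cos t / sqrt (1 - (a * sin t)\<^sup>2)" if "t \<in> {- pi / 2..pi / 2}" for t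
        using that a pos[of t] by (auto intro!: divide_nonneg_nonneg mult_nonneg_nonneg cos_ge_zero)
    qed auto
  next
    case False
    with a have [simp]: "a = 1" by simp
    show thesis
    proof (rule that[of "\<lambda>t. 2 * t" "\<lambda>t. 2"])
      show "((\<lambda>t. 2 * t) has_real_derivative 2) (at t)" for t
        by (auto intro!: derivative_eq_intros)
      show "2 = 2 * a * cos t / sqrt (1 - (a * sin t)\<^sup>2)" if "t \<in> {- pi / 2<..<pi / 2}" for t
        using that cos_gt_zero_pi[of t] by (simp add: cos_squared_eq[symmetric])
    qed (auto simp: arcsin_sin)
  qed
  have ends: "g (- pi / 2) = - (2 * arcsin a)" "g (pi / 2) = 2 * arcsin a"
    using a by (simp_all add: g arcsin_minus)
  have support: "arc_density a \<theta> = 0" if "\<theta> \<in> {- pi..pi}" "\<theta> \<notin> {- (2 * arcsin a)..2 * arcsin a}" for \<theta>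
  proof -
    have "arcsin a < \<bar>\<theta> / 2\<bar>" "\<bar>\<theta> / 2\<bar> \<le> pi / 2" using that by auto
    moreover have "- (pi / 2) \<le> arcsin a" using a by (intro arcsin_lbound) auto
    ultimately have "sin (arcsin a) \<le> sin \<bar>\<theta> / 2\<bar>" by (intro sin_monotone_2pi_le) auto
    then have "a \<le> \<bar>sin (\<theta> / 2)\<bar>" using a by (auto simp: abs_if split: if_splits)
    then have "a\<^sup>2 \<le> \<bar>sin (\<theta> / 2)\<bar>\<^sup>2" using a by (intro power_mono) auto
    then show ?thesis by (simp add: arc_density_def)
  qed
  have sub: "{- (2 * arcsin a)..2 * arcsin a} \<subseteq> {- pi..pi}"
    using arcsin_ubound[of a] a by auto
  have "(\<integral>\<^sup>+\<theta>. f \<theta> * ennreal (arc_density a \<theta>) * indicator {- pi..pi} \<theta> \<partial>lborel) =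
      (\<integral>\<^sup>+\<theta>. f \<theta> * ennreal (arc_density a \<theta>) * indicator {g (- pi / 2)..g (pi / 2)} \<theta> \<partial>lborel)"
    unfolding ends using support sub by (intro nn_integral_cong) (auto simp: indicator_def)
  also have "\<dots> = (\<integral>\<^sup>+t. f (g t) * ennreal (arc_density a (g t)) * ennreal (g' t) *
      indicator {- pi / 2..pi / 2} t \<partial>lborel)"
    by (rule nn_integral_substitution_aux[where f = "\<lambda>\<theta>. f \<theta> * ennreal (arc_density a \<theta>)", OF _ _ deriv cont nonneg])
       auto
  also have "\<dots> = (\<integral>\<^sup>+t. ennreal (1 / pi) * (f (2 * arcsin (a * sin t)) * indicator {- pi / 2..pi / 2} t) \<partial>lborel)"
  proof (rule nn_integral_cong_AE)
    have "AE t in lborel. t \<noteq> - pi / 2" "AE t in lborel. t \<noteq> pi / 2" by (rule AE_lborel_singleton)+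
    then show "AE t in lborel. f (g t) * ennreal (arc_density a (g t)) * ennreal (g' t) *
        indicator {- pi / 2..pi / 2} t =
        ennreal (1 / pi) * (f (2 * arcsin (a * sin t)) * indicator {- pi / 2..pi / 2} t)"
    proof eventually_elim
      case (elim t)
      show ?case
      proof (cases "t \<in> {- pi / 2..pi / 2}")
        case True
        with elim have t: "t \<in> {- pi / 2<..<pi / 2}" by auto
        then have c: "0 < cos t" by (auto intro: cos_gt_zero_pi)
        have s1: "(sin t)\<^sup>2 < 1" using c by (simp add: sin_squared_eq)
        have less: "(a * sin t)\<^sup>2 < a\<^sup>2" using s1 a by (simp add: power_mult_distrib)
        then have p: "0 < 1 - (a * sin t)\<^sup>2" using a power_le_one[of a 2] by linarith
        have "sqrt (a\<^sup>2 - (a * sin t)\<^sup>2) = sqrt ((a * cos t)\<^sup>2)"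
          by (simp add: power_mult_distrib cos_squared_eq algebra_simps)
        also have "\<dots> = a * cos t" using a c by simp
        finally have sq: "sqrt (a\<^sup>2 - (a * sin t)\<^sup>2) = a * cos t" .
        have "arc_density a (g t) = sqrt (1 - (a * sin t)\<^sup>2) / (2 * pi * (a * cos t))"
          using less bounds[of t] True by (simp add: arc_density_def g cos_arcsin sq)
        then have "arc_density a (g t) * g' t = 1 / pi"
          using p c a by (simp add: g'[OF t] field_simps)
        moreover have "0 \<le> g' t" "0 \<le> arc_density a (g t)"
          using nonneg[OF True] sub ends g[OF True] arcsin_bounded[OF bounds[of t]] 
          by (auto intro!: arc_density_nonneg)
        ultimately have "ennreal (arc_density a (g t)) * ennreal (g' t) = ennreal (1 / pi)"
          by (simp add: ennreal_mult[symmetric])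
        moreover have "f (g t) * ennreal (arc_density a (g t)) * ennreal (g' t) * indicator {- pi / 2..pi / 2} t =
            ennreal (arc_density a (g t)) * ennreal (g' t) * (f (g t) * indicator {- pi / 2..pi / 2} t)"
          by (simp only: mult_ac)
        ultimately show ?thesis using g[OF True] by simp
      qed simp
    qed
  qed
  also have "\<dots> = ennreal (1 / pi) * (\<integral>\<^sup>+t. f (2 * arcsin (a * sin t)) * indicator {- pi / 2..pi / 2} t \<partial>lborel)"
  proof (rule nn_integral_cmult)
    have "continuous_on UNIV (\<lambda>t. 2 * arcsin (a * sin t))"
      using bounds by (intro continuous_intros) auto
    then have [measurable]: "(\<lambda>t. 2 * arcsin (a * sin t)) \<in> borel_measurable borel"
      by (rule borel_measurable_continuous_onI)
    show "(\<lambda>t. f (2 * arcsin (a * sin t)) * indicator {- pi / 2..pi / 2} t) \<in> borel_measurable lborel"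
      by measurable
  qed
  finally show ?thesis .
qed

text \<open>The logarithmic kernel, shifted by the logarithm of the diameter of the circle to make it
nonnegative, so that Tonelli's theorem applies.  At \<open>\<phi> = \<theta>\<close> it has the finite default value \<open>ln 2\<close>.\<close>

definition log_kernel :: "real \<Rightarrow> real \<Rightarrow> real" where
  "log_kernel \<phi> \<theta> = ln 2 - ln (norm (cis \<phi> - cis \<theta>))"

lemma log_kernel_nonneg: "0 \<le> log_kernel \<phi> \<theta>"
proof (cases "sin ((\<phi> - \<theta>) / 2) = 0")
  case False
  then show ?thesis unfolding log_kernel_def norm_cis_diff by (simp add: ln_mult abs_sin_le_one)
qed (simp add: log_kernel_def norm_cis_diff)

lemma log_kernel_eq: "sin ((\<phi> - \<theta>) / 2) \<noteq> 0 \<Longrightarrow> log_kernel \<phi> \<theta> = - ln \<bar>sin ((\<phi> - \<theta>) / 2)\<bar>"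
  unfolding log_kernel_def norm_cis_diff by (simp add: ln_mult)

lemma borel_measurable_log_kernel [measurable]: "log_kernel \<phi> \<in> borel_measurable borel"
  unfolding log_kernel_def norm_cis_diff by measurable

lemma arc_potential_le_ln2:
  assumes "\<bar>y\<bar> \<le> 1" "0 \<le> a" "a \<le> 1"
  shows "arc_potential y a \<le> ln 2"
proof -
  have "y\<^sup>2 \<le> 1" using assms by (simp add: abs_square_le_1)
  then have "y\<^sup>2 - a\<^sup>2 \<le> 1" using zero_le_power2[of a] by linarith
  then have "sqrt (max 0 (y\<^sup>2 - a\<^sup>2)) \<le> 1" by auto
  then have "max \<bar>y\<bar> a + sqrt (max 0 (y\<^sup>2 - a\<^sup>2)) \<le> 1 + 1" using assms by (intro add_mono) auto
  moreover have "0 \<le> max \<bar>y\<bar> a + sqrt (max 0 (y\<^sup>2 - a\<^sup>2))" using assms by simp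
  ultimately show ?thesis
    unfolding arc_potential_def by (metis ln_0 ln_ge_zero ln_mono one_add_one one_le_numeral order_le_less)
qed

text \<open>Averaging the kernel over \<open>t\<close> and \<open>- t\<close> turns the pair of sines into \<open>y\<^sup>2 - a\<^sup>2 sin\<^sup>2 t\<close>.\<close>

lemma nn_integral_log_kernel_arc_density:
  assumes a: "0 < a" "a \<le> 1"
  shows "(\<integral>\<^sup>+\<theta>. ennreal (log_kernel \<phi> \<theta>) * ennreal (arc_density a \<theta>) * indicator {- pi..pi} \<theta> \<partial>lborel) =
    ennreal (ln 2 - arc_potential (sin (\<phi> / 2)) a)"
proof -
  define y where "y = sin (\<phi> / 2)"
  define w where "w = (\<lambda>t. arcsin (a * sin t))"
  define k where "k = (\<lambda>t. log_kernel \<phi> (2 * w t))"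
  let ?I = "{- pi / 2..pi / 2}"
  have "\<bar>a * sin t\<bar> \<le> 1" for t
    using a mult_mono[of a 1 "\<bar>sin t\<bar>" 1] by (simp add: abs_mult)
  then have bounds: "- 1 \<le> a * sin t" "a * sin t \<le> 1" for t by (auto simp: abs_le_iff minus_le_iff)
  have "continuous_on UNIV w"
    unfolding w_def using bounds by (intro continuous_intros) auto
  then have [measurable]: "w \<in> borel_measurable borel" by (rule borel_measurable_continuous_onI)
  have [measurable]: "k \<in> borel_measurable borel" unfolding k_def by measurable
  have w_minus: "w (- t) = - w t" for t unfolding w_def using bounds[of t] by (simp add: arcsin_minus)
  have sin_w: "sin (w t) = a * sin t" for t unfolding w_def using bounds[of t] by simp
  have k0: "0 \<le> k t" for t by (simp add: k_def log_kernel_nonneg)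
  define X where "X = (\<integral>\<^sup>+t. ennreal (k t) * indicator ?I t \<partial>lborel)"
  have "X = (\<integral>\<^sup>+t. ennreal (k (- t)) * indicator ?I (- t) \<partial>lborel)"
    unfolding X_def by (subst nn_integral_real_affine[where c = "- 1" and t = 0]) auto
  also have "\<dots> = (\<integral>\<^sup>+t. ennreal (k (- t)) * indicator ?I t \<partial>lborel)"
    by (intro nn_integral_cong) (auto simp: indicator_def)
  finally have X': "X = (\<integral>\<^sup>+t. ennreal (k (- t)) * indicator ?I t \<partial>lborel)" .
  have "X + X = (\<integral>\<^sup>+t. ennreal (k t) * indicator ?I t + ennreal (k (- t)) * indicator ?I t \<partial>lborel)"
    by (subst X', unfold X_def, subst nn_integral_add) (auto simp: add.commute)
  also have "\<dots> = (\<integral>\<^sup>+t. ennreal (indicator ?I t * - ln \<bar>y\<^sup>2 - a\<^sup>2 * (sin t)\<^sup>2\<bar>) \<partial>lborel)"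
  proof (rule nn_integral_cong_AE)
    have "AE t in lborel. t \<noteq> arcsin (y / a)" "AE t in lborel. t \<noteq> - arcsin (y / a)"
      by (rule AE_lborel_singleton)+
    then show "AE t in lborel. ennreal (k t) * indicator ?I t + ennreal (k (- t)) * indicator ?I t =
        ennreal (indicator ?I t * - ln \<bar>y\<^sup>2 - a\<^sup>2 * (sin t)\<^sup>2\<bar>)"
    proof eventually_elim
      case (elim t)
      show ?case
      proof (cases "t \<in> ?I")
        case True
        have prod: "y\<^sup>2 - a\<^sup>2 * (sin t)\<^sup>2 = sin (\<phi> / 2 - w t) * sin (\<phi> / 2 + w t)"
        proof -
          have "sin (\<phi> / 2 - w t) * sin (\<phi> / 2 + w t) =
              (sin (\<phi> / 2))\<^sup>2 * (cos (w t))\<^sup>2 - (cos (\<phi> / 2))\<^sup>2 * (sin (w t))\<^sup>2"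
            unfolding sin_add sin_diff by (simp add: power2_eq_square algebra_simps)
          also have "\<dots> = (sin (\<phi> / 2))\<^sup>2 - (sin (w t))\<^sup>2"
            by (simp add: cos_squared_eq algebra_simps)
          finally show ?thesis by (simp add: y_def sin_w power_mult_distrib)
        qed
        have "y\<^sup>2 - a\<^sup>2 * (sin t)\<^sup>2 \<noteq> 0"
        proof
          assume "y\<^sup>2 - a\<^sup>2 * (sin t)\<^sup>2 = 0"
          then have "y\<^sup>2 = (a * sin t)\<^sup>2" by (simp add: power_mult_distrib)
          then have "y = a * sin t \<or> y = - (a * sin t)" by (simp add: power2_eq_iff)
          then have "y / a = sin t \<or> y / a = sin (- t)" using a by auto
          then have "arcsin (y / a) = t \<or> arcsin (y / a) = - t"
            using True by (metis arcsin_sin atLeastAtMost_iff minus_divide_left neg_le_iff_le minus_minus)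
          then show False using elim by auto
        qed
        then have nz: "sin (\<phi> / 2 - w t) \<noteq> 0" "sin (\<phi> / 2 + w t) \<noteq> 0" unfolding prod by auto
        have half: "(\<phi> - 2 * w t) / 2 = \<phi> / 2 - w t" "(\<phi> - 2 * w (- t)) / 2 = \<phi> / 2 + w t"
          by (simp_all add: w_minus field_simps)
        have "k t + k (- t) = - ln \<bar>y\<^sup>2 - a\<^sup>2 * (sin t)\<^sup>2\<bar>"
          unfolding k_def prod
          using nz log_kernel_eq[of \<phi> "2 * w t", unfolded half] log_kernel_eq[of \<phi> "2 * w (- t)", unfolded half]
          by (simp add: abs_mult ln_mult)
        then show ?thesis using True k0 by (simp add: ennreal_plus[symmetric] del: ennreal_plus)
      qed simp
    qed
  qed
  also have "\<dots> = ennreal (2 * pi * (ln 2 - arc_potential y a))"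
  proof (rule nn_integral_has_integral_lebesgue)
    fix t :: real
    have "(sin t)\<^sup>2 \<le> 1" "y\<^sup>2 \<le> 1" unfolding y_def by (simp_all only: abs_square_le_1 abs_sin_le_one)
    moreover have "a\<^sup>2 \<le> 1" using a by (simp add: abs_square_le_1)
    ultimately have "a\<^sup>2 * (sin t)\<^sup>2 \<le> 1" by (intro mult_le_one) auto
    moreover have "0 \<le> a\<^sup>2 * (sin t)\<^sup>2" "0 \<le> y\<^sup>2" by simp_all
    ultimately have "\<bar>y\<^sup>2 - a\<^sup>2 * (sin t)\<^sup>2\<bar> \<le> 1"
      using \<open>y\<^sup>2 \<le> 1\<close> unfolding abs_le_iff by linarith
    then show "0 \<le> - ln \<bar>y\<^sup>2 - a\<^sup>2 * (sin t)\<^sup>2\<bar>"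
      by (cases "y\<^sup>2 - a\<^sup>2 * (sin t)\<^sup>2 = 0") (auto simp: ln_le_zero_iff)
  next
    show "((\<lambda>t. - ln \<bar>y\<^sup>2 - a\<^sup>2 * (sin t)\<^sup>2\<bar>) has_integral 2 * pi * (ln 2 - arc_potential y a)) ?I"
      using has_integral_neg[OF has_integral_arc_potential[OF a(1), of y]] by (simp add: algebra_simps)
  qed
  finally have XX: "X + X = ennreal (2 * pi * (ln 2 - arc_potential y a))" .
  have le: "0 \<le> ln 2 - arc_potential y a"
    using arc_potential_le_ln2[of y a] a by (simp add: y_def)
  have "X \<noteq> top" using XX by auto
  then obtain x where x: "X = ennreal x" "0 \<le> x" by (cases X) auto
  then have "x + x = 2 * pi * (ln 2 - arc_potential y a)"
    using XX le by (simp add: ennreal_plus[symmetric] del: ennreal_plus)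
  then have "X = ennreal (pi * (ln 2 - arc_potential y a))" using x by simp
  then have "ennreal (1 / pi) * X = ennreal (ln 2 - arc_potential y a)"
    using le by (simp add: ennreal_mult[symmetric])
  moreover have "(\<integral>\<^sup>+\<theta>. ennreal (log_kernel \<phi> \<theta>) * ennreal (arc_density a \<theta>) * indicator {- pi..pi} \<theta> \<partial>lborel) =
      ennreal (1 / pi) * X"
    unfolding X_def k_def w_def by (rule nn_integral_arc_density[OF _ a]) measurable
  ultimately show ?thesis by (simp add: y_def)
qed

section \<open>The constrained measure as a mixture of equilibrium measures\<close>

text \<open>The arc with parameter \<open>u\<close> is \<open>|sin (\<theta> / 2)| \<le> arc_radius \<alpha> u\<close>; for \<open>u = 1 / \<xi>\<close> it is
\<open>|\<theta>| \<le> beta \<alpha> \<xi>\<close>.\<close>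

definition arc_radius :: "real \<Rightarrow> real \<Rightarrow> real" where
  "arc_radius \<alpha> u = sqrt (1 - (cos (\<alpha> / 2) / cos (pi * u / 2))\<^sup>2)"

lemma rho_measurable [measurable]: "rho a x \<in> borel_measurable borel"
  unfolding rho_def[abs_def] by measurable

lemma arc_radius_measurable [measurable]: "arc_radius a \<in> borel_measurable borel"
  unfolding arc_radius_def[abs_def] by measurable

lemma arc_potential_radius_measurable [measurable]:
  "(\<lambda>u. arc_potential y (arc_radius a u)) \<in> borel_measurable borel"
  unfolding arc_potential_def by measurable

text \<open>Here \<open>s\<close> stands for \<open>1 / \<xi>\<close>; the assumptions are those on \<open>\<alpha>\<close> and \<open>\<xi>\<close>.\<close>

locale arc_parameters =
  fixes \<alpha> s :: real
  assumes alpha: "0 < \<alpha>" "\<alpha> \<le> pi" and s_pos: "0 < s" and s_le: "s \<le> \<alpha> / pi" and s_less: "s < 1"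
begin

lemma half_angle_bounds:
  assumes "0 \<le> u" "u \<le> s"
  shows "0 \<le> pi * u / 2" "pi * u / 2 \<le> \<alpha> / 2" "pi * u / 2 < pi / 2"
proof -
  have "u \<le> \<alpha> / pi" "u < 1" using assms s_le s_less by auto
  then show "pi * u / 2 \<le> \<alpha> / 2" "pi * u / 2 < pi / 2" by (auto simp: field_simps)
qed (use assms in auto)

lemma cos_angle:
  assumes "0 \<le> u" "u \<le> s"
  shows "0 < cos (pi * u / 2)" "cos (\<alpha> / 2) \<le> cos (pi * u / 2)" "0 \<le> cos (\<alpha> / 2)"
  using half_angle_bounds[OF assms] alpha
  by (auto intro!: cos_gt_zero_pi cos_monotone_0_pi_le cos_ge_zero simp: field_simps)

lemma cos_ratio_bounds:
  assumes "0 \<le> u" "u \<le> s"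
  shows "0 \<le> cos (\<alpha> / 2) / cos (pi * u / 2)" "cos (\<alpha> / 2) / cos (pi * u / 2) \<le> 1"
  using cos_angle[OF assms] by auto

lemma arc_radius_square:
  assumes "0 \<le> u" "u \<le> s"
  shows "(arc_radius \<alpha> u)\<^sup>2 = 1 - (cos (\<alpha> / 2) / cos (pi * u / 2))\<^sup>2"
  using cos_ratio_bounds[OF assms] by (simp add: arc_radius_def power_le_one del: power_divide)

lemma arc_radius_bounds:
  assumes "0 \<le> u" "u \<le> s"
  shows "0 \<le> arc_radius \<alpha> u" "arc_radius \<alpha> u \<le> 1"
  using cos_ratio_bounds[OF assms] by (auto simp: arc_radius_def power_le_one simp del: power_divide)

lemma arc_radius_pos:
  assumes "0 \<le> u" "u < s"
  shows "0 < arc_radius \<alpha> u"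
proof -
  have "u < \<alpha> / pi" using assms s_le by auto
  then have "pi * u / 2 < \<alpha> / 2" by (auto simp: field_simps)
  then have "cos (\<alpha> / 2) < cos (pi * u / 2)"
    using alpha assms by (intro cos_monotone_0_pi) auto
  then have "cos (\<alpha> / 2) / cos (pi * u / 2) < 1"
    using cos_angle[of u] assms by (simp add: field_simps)
  then show ?thesis
    using cos_ratio_bounds[of u] assms by (simp add: arc_radius_def abs_square_less_1 del: power_divide)
qed

lemma inverse_admissible: "pi / \<alpha> \<le> 1 / s" "(\<alpha>, 1 / s) \<noteq> (pi, 1)"
  using alpha s_pos s_le s_less by (auto simp: field_simps)

lemma cos_beta: "cos (beta \<alpha> (1 / s)) = 1 - 2 * (arc_radius \<alpha> s)\<^sup>2"
  and beta_bounds: "0 \<le> beta \<alpha> (1 / s)" "beta \<alpha> (1 / s) \<le> \<alpha>"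
proof -
  have b: "beta \<alpha> (1 / s) \<in> {0..\<alpha>} \<and>
      cos (beta \<alpha> (1 / s)) = cos \<alpha> + (1 + cos \<alpha>) * (tan (pi / (2 * (1 / s))))\<^sup>2"
    using beta_characterization[OF alpha inverse_admissible] by blast
  then show "0 \<le> beta \<alpha> (1 / s)" "beta \<alpha> (1 / s) \<le> \<alpha>" by auto
  have c: "0 < cos (pi * s / 2)" using cos_angle[of s] s_pos by simp
  have "cos (2 * (\<alpha> / 2)) = 2 * (cos (\<alpha> / 2))\<^sup>2 - 1" by (rule cos_double_cos)
  then have 1: "cos \<alpha> = 2 * (cos (\<alpha> / 2))\<^sup>2 - 1" by simp
  have "(tan (pi * s / 2))\<^sup>2 = 1 / (cos (pi * s / 2))\<^sup>2 - 1"
    using c by (simp add: tan_def power_divide sin_squared_eq diff_divide_distrib)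
  with b 1 show "cos (beta \<alpha> (1 / s)) = 1 - 2 * (arc_radius \<alpha> s)\<^sup>2"
    using s_pos by (simp add: arc_radius_square power_divide algebra_simps)
qed

lemma sin_half_beta: "sin (beta \<alpha> (1 / s) / 2) = arc_radius \<alpha> s"
proof (rule power2_eq_imp_eq)
  have "cos (2 * (beta \<alpha> (1 / s) / 2)) = 1 - 2 * (sin (beta \<alpha> (1 / s) / 2))\<^sup>2" by (rule cos_double_sin)
  with cos_beta show "(sin (beta \<alpha> (1 / s) / 2))\<^sup>2 = (arc_radius \<alpha> s)\<^sup>2" by simp
  show "0 \<le> sin (beta \<alpha> (1 / s) / 2)" using beta_bounds alpha by (intro sin_ge_zero) auto
  show "0 \<le> arc_radius \<alpha> s" using arc_radius_bounds s_pos by auto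
qed

text \<open>In terms of \<open>c = cos (\<theta> / 2)\<close> and \<open>C = cos (\<alpha> / 2)\<close> the quantity under the root of the equilibrium
density is \<open>c\<^sup>2 - C\<^sup>2 / cos\<^sup>2 (pi u / 2)\<close>.\<close>

lemma arc_radius_gap:
  assumes "0 \<le> u" "u \<le> s"
  shows "(arc_radius \<alpha> u)\<^sup>2 - (sin (\<theta> / 2))\<^sup>2 =
    ((cos (\<theta> / 2) * cos (pi * u / 2))\<^sup>2 - (cos (\<alpha> / 2))\<^sup>2) / (cos (pi * u / 2))\<^sup>2"
  using cos_angle(1)[OF assms]
  by (simp add: arc_radius_square[OF assms] sin_squared_eq power_divide power_mult_distrib diff_divide_distrib)

text \<open>The primitive in \<open>u\<close> of the equilibrium densities is an arcsine, which stays at its maximal value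
once the shrinking arc has passed the point \<open>\<theta>\<close>; there the density \<open>rho\<close> meets its constraint.\<close>

lemma nn_integral_mixture:
  assumes \<theta>: "\<bar>\<theta>\<bar> < \<alpha>"
  shows "(\<integral>\<^sup>+u. ennreal (arc_density (arc_radius \<alpha> u) \<theta>) * indicator {0..s} u \<partial>lborel) =
    ennreal (s * rho \<alpha> (1 / s) \<theta>)"
proof -
  define c where "c = cos (\<theta> / 2)"
  define C where "C = cos (\<alpha> / 2)"
  define R where "R = sqrt (c\<^sup>2 - C\<^sup>2)"
  have C0: "0 \<le> C" using cos_angle(3)[of 0] s_pos by (simp add: C_def)
  have "cos (\<alpha> / 2) < cos \<bar>\<theta> / 2\<bar>" using \<theta> alpha by (intro cos_monotone_0_pi) auto
  then have Cc: "C < c" by (simp add: C_def c_def abs_if split: if_splits)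
  have c0: "0 < c" using C0 Cc by simp
  have "C\<^sup>2 < c\<^sup>2" using C0 Cc by (intro power_strict_mono) auto
  then have R: "0 < R" "R\<^sup>2 = c\<^sup>2 - C\<^sup>2" by (auto simp: R_def)
  define z where "z = (\<lambda>u. c * sin (pi * u / 2) / R)"
  have z0: "0 \<le> z u" if "0 \<le> u" "u \<le> s" for u
    unfolding z_def using c0 R(1) half_angle_bounds[OF that] by (auto intro!: mult_nonneg_nonneg divide_nonneg_nonneg sin_ge_zero)
  have gap: "R\<^sup>2 * (1 - (z u)\<^sup>2) = (c * cos (pi * u / 2))\<^sup>2 - C\<^sup>2" for u
  proof -
    have "R\<^sup>2 * (1 - (z u)\<^sup>2) = R\<^sup>2 - c\<^sup>2 * (sin (pi * u / 2))\<^sup>2"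
      using R(1) by (simp add: z_def power_mult_distrib power_divide field_simps)
    then show ?thesis by (simp add: R(2) power_mult_distrib sin_squared_eq algebra_simps)
  qed
  have diff: "(arc_radius \<alpha> u)\<^sup>2 - (sin (\<theta> / 2))\<^sup>2 = R\<^sup>2 * (1 - (z u)\<^sup>2) / (cos (pi * u / 2))\<^sup>2"
    if "0 \<le> u" "u \<le> s" for u
    unfolding gap arc_radius_gap[OF that] by (simp add: c_def C_def)
  have inside: "(sin (\<theta> / 2))\<^sup>2 < (arc_radius \<alpha> u)\<^sup>2 \<longleftrightarrow> z u < 1" if "0 \<le> u" "u \<le> s" for u
  proof -
    have "(sin (\<theta> / 2))\<^sup>2 < (arc_radius \<alpha> u)\<^sup>2 \<longleftrightarrow> 0 < R\<^sup>2 * (1 - (z u)\<^sup>2) / (cos (pi * u / 2))\<^sup>2"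
      unfolding diff[OF that, symmetric] by simp
    also have "\<dots> \<longleftrightarrow> (z u)\<^sup>2 < 1"
      using R(1) cos_angle(1)[OF that] by (simp add: zero_less_divide_iff zero_less_mult_iff)
    also have "\<dots> \<longleftrightarrow> z u < 1" using z0[OF that] by (simp add: abs_square_less_1)
    finally show ?thesis .
  qed
  have root: "sqrt ((arc_radius \<alpha> u)\<^sup>2 - (sin (\<theta> / 2))\<^sup>2) = R * sqrt (1 - (z u)\<^sup>2) / cos (pi * u / 2)"
    if "0 \<le> u" "u \<le> s" for u
    unfolding diff[OF that] using R(1) cos_angle(1)[OF that] by (simp add: real_sqrt_divide real_sqrt_mult)
  define A where "A = (\<lambda>u. arcsin (min 1 (z u)) / pi\<^sup>2)"
  \<comment> \<open>The parameter at which the shrinking arc reaches \<open>\<theta>\<close>.\<close>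
  define u0 where "u0 = 2 / pi * arcsin (R / c)"
  have RI: "((\<lambda>u. arc_density (arc_radius \<alpha> u) \<theta>) has_integral A s - A 0) {0..s}"
  proof (rule fundamental_theorem_of_calculus_interior_strong)
    show "finite {u0}" "0 \<le> s" using s_pos by auto
    have "continuous_on {0..s} z" unfolding z_def using R(1) by (intro continuous_intros) auto
    moreover have "- 1 \<le> min 1 (z u) \<and> min 1 (z u) \<le> 1" if "u \<in> {0..s}" for u
      using z0[of u] that by auto
    ultimately show "continuous_on {0..s} A" unfolding A_def by (intro continuous_intros) auto
    fix u assume u: "u \<in> {0<..<s} - {u0}"
    then have us: "0 \<le> u" "u \<le> s" by auto
    have contz: "isCont z u" unfolding z_def using R(1) by (intro continuous_intros) auto
    have "z u \<noteq> 1"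
    proof
      assume "z u = 1"
      then have "sin (pi * u / 2) = R / c" using R(1) c0 by (simp add: z_def field_simps)
      moreover have "arcsin (sin (pi * u / 2)) = pi * u / 2"
        using half_angle_bounds[OF us] pi_gt_zero by (intro arcsin_sin) linarith+
      ultimately have "u = u0" by (simp add: u0_def field_simps)
      with u show False by auto
    qed
    then consider "z u < 1" | "1 < z u" by linarith
    then show "(A has_vector_derivative arc_density (arc_radius \<alpha> u) \<theta>) (at u)"
      unfolding has_real_derivative_iff_has_vector_derivative[symmetric]
    proof cases
      case 1
      have near: "\<forall>\<^sub>F v in nhds u. arcsin (z v) / pi\<^sup>2 = A v"
      proof -
        have "\<forall>\<^sub>F v in nhds u. z v < 1"
          using contz 1 by (auto simp: isCont_def tendsto_at_iff_tendsto_nhds intro: order_tendstoD)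
        then show ?thesis by eventually_elim (simp add: A_def)
      qed
      have z1: "- 1 < z u" "0 < 1 - (z u)\<^sup>2" using z0[OF us] 1 by (auto simp: abs_square_less_1)
      have "(z has_real_derivative c * (cos (pi * u / 2) * (pi / 2)) / R) (at u)"
        unfolding z_def using R(1) by (auto intro!: derivative_eq_intros)
      from DERIV_cdivide[OF DERIV_chain2[OF DERIV_arcsin[OF z1(1) 1] this]]
      have "((\<lambda>v. arcsin (z v) / pi\<^sup>2) has_real_derivative
          inverse (sqrt (1 - (z u)\<^sup>2)) * (c * (cos (pi * u / 2) * (pi / 2)) / R) / pi\<^sup>2) (at u)" .
      also have "inverse (sqrt (1 - (z u)\<^sup>2)) * (c * (cos (pi * u / 2) * (pi / 2)) / R) / pi\<^sup>2 =
          arc_density (arc_radius \<alpha> u) \<theta>"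
      proof -
        have "arc_density (arc_radius \<alpha> u) \<theta> = c / (2 * pi * (R * sqrt (1 - (z u)\<^sup>2) / cos (pi * u / 2)))"
          using iffD2[OF inside[OF us] 1] by (simp add: arc_density_def root[OF us] c_def)
        then show ?thesis
          using R(1) z1 cos_angle(1)[OF us] by (simp add: field_simps power2_eq_square[of pi])
      qed
      finally show "(A has_real_derivative arc_density (arc_radius \<alpha> u) \<theta>) (at u)"
        using near by (subst DERIV_cong_ev[OF refl _ refl, of A "\<lambda>v. arcsin (z v) / pi\<^sup>2"])
          (auto elim: eventually_mono)
    next
      case 2
      have "\<forall>\<^sub>F v in nhds u. 1 < z v"
        using contz 2 by (auto simp: isCont_def tendsto_at_iff_tendsto_nhds intro: order_tendstoD)
      then have "\<forall>\<^sub>F v in nhds u. A v = pi / 2 / pi\<^sup>2" by eventually_elim (simp add: A_def)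
      then have "(A has_real_derivative 0) (at u)"
        by (subst DERIV_cong_ev[OF refl _ refl, of A "\<lambda>v. pi / 2 / pi\<^sup>2"]) auto
      moreover have "arc_density (arc_radius \<alpha> u) \<theta> = 0"
        using 2 by (simp add: arc_density_def inside[OF us])
      ultimately show "(A has_real_derivative arc_density (arc_radius \<alpha> u) \<theta>) (at u)" by simp
    qed
  qed
  have "A 0 = 0" by (simp add: A_def z_def)
  have ss: "0 \<le> s" "s \<le> s" using s_pos by auto
  have "A s = s * rho \<alpha> (1 / s) \<theta>"
  proof -
    have "\<bar>\<theta>\<bar> < beta \<alpha> (1 / s) \<longleftrightarrow> cos (beta \<alpha> (1 / s)) < cos \<bar>\<theta>\<bar>"
      using beta_bounds alpha \<theta> by (intro cos_mono_less_eq[symmetric]) auto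
    also have "\<dots> \<longleftrightarrow> cos (beta \<alpha> (1 / s)) < cos (2 * (\<theta> / 2))" by (simp add: abs_if)
    also have "\<dots> \<longleftrightarrow> z s < 1" unfolding cos_beta cos_double_sin inside[OF ss, symmetric] by auto
    finally have iff: "\<bar>\<theta>\<bar> < beta \<alpha> (1 / s) \<longleftrightarrow> z s < 1" .
    show ?thesis
    proof (cases "z s < 1")
      case False
      then show ?thesis using iff s_pos by (simp add: rho_def A_def power2_eq_square)
    next
      case True
      have z1: "- 1 < z s" "0 < 1 - (z s)\<^sup>2" using z0[OF ss] True by (auto simp: abs_square_less_1)
      have "cos (2 * (\<theta> / 2)) - cos (beta \<alpha> (1 / s)) = 2 * ((arc_radius \<alpha> s)\<^sup>2 - (sin (\<theta> / 2))\<^sup>2)"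
        unfolding cos_beta cos_double_sin by simp
      then have "cos \<theta> - cos (beta \<alpha> (1 / s)) = 2 * ((arc_radius \<alpha> s)\<^sup>2 - (sin (\<theta> / 2))\<^sup>2)" by simp
      then have "sqrt (cos \<theta> - cos (beta \<alpha> (1 / s))) = sqrt 2 * (R * sqrt (1 - (z s)\<^sup>2) / cos (pi * s / 2))"
        by (simp only: real_sqrt_mult root[OF ss])
      moreover have "tan (pi * s / 2) * (c * cos (pi * s / 2)) = R * z s"
        using R(1) cos_angle(1)[OF ss] by (simp add: tan_def z_def)
      moreover have "sqrt 2 * T * c / (sqrt 2 * (R * q / k)) = T * c * k / (R * q)" for T q k :: real
        by (simp add: field_simps)
      ultimately have "sqrt 2 * tan (pi / (2 * (1 / s))) * cos (\<theta> / 2) / sqrt (cos \<theta> - cos (beta \<alpha> (1 / s))) =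
          z s / sqrt (1 - (z s)\<^sup>2)"
        using R(1) by (simp add: c_def[symmetric])
      moreover have "arcsin (z s) = arctan (z s / sqrt (1 - (z s)\<^sup>2))"
        using z1 True by (intro arcsin_arctan) auto
      ultimately show ?thesis using True iff s_pos by (simp add: rho_def A_def)
    qed
  qed
  with RI \<open>A 0 = 0\<close> have "((\<lambda>u. arc_density (arc_radius \<alpha> u) \<theta>) has_integral s * rho \<alpha> (1 / s) \<theta>) {0..s}"
    by simp
  moreover have "0 \<le> arc_density a \<theta>" for a using \<theta> alpha by (intro arc_density_nonneg) auto
  ultimately have "(\<integral>\<^sup>+u. ennreal (indicator {0..s} u * arc_density (arc_radius \<alpha> u) \<theta>) \<partial>lborel) =
      ennreal (s * rho \<alpha> (1 / s) \<theta>)"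
    by (intro nn_integral_has_integral_lebesgue)
  moreover have "(\<integral>\<^sup>+u. ennreal (arc_density (arc_radius \<alpha> u) \<theta>) * indicator {0..s} u \<partial>lborel) =
      (\<integral>\<^sup>+u. ennreal (indicator {0..s} u * arc_density (arc_radius \<alpha> u) \<theta>) \<partial>lborel)"
    by (intro nn_integral_cong) (auto simp: indicator_def)
  ultimately show ?thesis by simp
qed


lemma arc_density_outside:
  assumes "0 \<le> u" "u \<le> s" "\<alpha> \<le> \<bar>\<theta>\<bar>" "\<bar>\<theta>\<bar> \<le> pi"
  shows "arc_density (arc_radius \<alpha> u) \<theta> = 0"
proof -
  have c: "0 \<le> cos (\<theta> / 2)" using assms by (intro cos_ge_zero) auto
  have "cos \<bar>\<theta> / 2\<bar> \<le> cos (\<alpha> / 2)" using assms alpha by (intro cos_monotone_0_pi_le) auto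
  then have "cos (\<theta> / 2) \<le> cos (\<alpha> / 2)" by (simp add: abs_if split: if_splits)
  moreover have "cos (\<theta> / 2) * cos (pi * u / 2) \<le> cos (\<theta> / 2)" using c by (intro mult_left_le) auto
  ultimately have "(cos (\<theta> / 2) * cos (pi * u / 2))\<^sup>2 \<le> (cos (\<alpha> / 2))\<^sup>2"
    using c cos_angle(1)[OF assms(1,2)] by (intro power_mono mult_nonneg_nonneg) auto
  then have "(arc_radius \<alpha> u)\<^sup>2 - (sin (\<theta> / 2))\<^sup>2 \<le> 0"
    unfolding arc_radius_gap[OF assms(1,2)] by (intro divide_nonpos_nonneg) auto
  then show ?thesis by (simp add: arc_density_def)
qed

lemma nn_integral_rho:
  fixes f :: "real \<Rightarrow> ennreal"
  assumes [measurable]: "f \<in> borel_measurable borel"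
  shows "(\<integral>\<^sup>+\<theta>. f \<theta> * ennreal (s * rho \<alpha> (1 / s) \<theta>) * indicator {- \<alpha>..\<alpha>} \<theta> \<partial>lborel) =
    (\<integral>\<^sup>+u. (\<integral>\<^sup>+\<theta>. f \<theta> * ennreal (arc_density (arc_radius \<alpha> u) \<theta>) * indicator {- pi..pi} \<theta> \<partial>lborel) *
      indicator {0..s} u \<partial>lborel)"
proof -
  let ?g = "\<lambda>\<theta> u. f \<theta> * indicator {- pi..pi} \<theta> *
    (ennreal (arc_density (arc_radius \<alpha> u) \<theta>) * indicator {0..s} u)"
  have "(\<integral>\<^sup>+\<theta>. f \<theta> * ennreal (s * rho \<alpha> (1 / s) \<theta>) * indicator {- \<alpha>..\<alpha>} \<theta> \<partial>lborel) =
      (\<integral>\<^sup>+\<theta>. (\<integral>\<^sup>+u. ?g \<theta> u \<partial>lborel) \<partial>lborel)"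
  proof (rule nn_integral_cong_AE)
    have "AE \<theta> in lborel. \<theta> \<noteq> \<alpha>" "AE \<theta> in lborel. \<theta> \<noteq> - \<alpha>" by (rule AE_lborel_singleton)+
    then show "AE \<theta> in lborel. f \<theta> * ennreal (s * rho \<alpha> (1 / s) \<theta>) * indicator {- \<alpha>..\<alpha>} \<theta> =
        (\<integral>\<^sup>+u. ?g \<theta> u \<partial>lborel)"
    proof eventually_elim
      case (elim \<theta>)
      have eq: "(\<integral>\<^sup>+u. ?g \<theta> u \<partial>lborel) = f \<theta> * indicator {- pi..pi} \<theta> *
          (\<integral>\<^sup>+u. ennreal (arc_density (arc_radius \<alpha> u) \<theta>) * indicator {0..s} u \<partial>lborel)"
        by (rule nn_integral_cmult) measurable
      show ?case
      proof (cases "\<bar>\<theta>\<bar> < \<alpha>")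
        case True
        then show ?thesis unfolding eq nn_integral_mixture[OF True] using alpha by (auto simp: indicator_def)
      next
        case False
        have "?g \<theta> u = 0" for u
          using False arc_density_outside[of u \<theta>] by (auto simp: indicator_def)
        then have "(\<integral>\<^sup>+u. ?g \<theta> u \<partial>lborel) = 0" by (simp only: nn_integral_const) simp
        then show ?thesis using False elim by (auto simp: indicator_def)
      qed
    qed
  qed
  also have "\<dots> = (\<integral>\<^sup>+u. (\<integral>\<^sup>+\<theta>. ?g \<theta> u \<partial>lborel) \<partial>lborel)"
    by (rule lborel_pair.Fubini'[symmetric]) measurable
  also have "\<dots> = (\<integral>\<^sup>+u. (\<integral>\<^sup>+\<theta>. f \<theta> * ennreal (arc_density (arc_radius \<alpha> u) \<theta>) * indicator {- pi..pi} \<theta> \<partial>lborel) *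
      indicator {0..s} u \<partial>lborel)"
    by (subst nn_integral_multc[symmetric]) (auto simp: mult_ac)
  finally show ?thesis .
qed

lemma rho_bounds:
  assumes "\<bar>\<theta>\<bar> \<le> \<alpha>"
  shows "0 \<le> rho \<alpha> (1 / s) \<theta>" "s * rho \<alpha> (1 / s) \<theta> \<le> 1 / (2 * pi)"
proof -
  define x where "x = sqrt 2 * tan (pi / (2 * (1 / s))) * cos (\<theta> / 2) / sqrt (cos \<theta> - cos (beta \<alpha> (1 / s)))"
  have rho: "rho \<alpha> (1 / s) \<theta> = (if \<bar>\<theta>\<bar> < beta \<alpha> (1 / s) then 1 / s / pi\<^sup>2 * arctan x else 1 / s / (2 * pi))"
    by (simp add: rho_def x_def)
  have "arctan x \<le> pi / 2" using arctan_ubound[of x] by simp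
  then have "arctan x / pi\<^sup>2 \<le> pi / 2 / pi\<^sup>2" by (rule divide_right_mono) simp
  then show "s * rho \<alpha> (1 / s) \<theta> \<le> 1 / (2 * pi)"
    using s_pos by (simp add: rho power2_eq_square)
  have "0 \<le> x" if "\<bar>\<theta>\<bar> < beta \<alpha> (1 / s)"
  proof -
    have "0 < tan (pi * s / 2)" using half_angle_bounds[of s] s_pos by (intro tan_gt_zero) auto
    moreover have "0 \<le> cos (\<theta> / 2)" using assms alpha by (intro cos_ge_zero) auto
    moreover have "cos (beta \<alpha> (1 / s)) \<le> cos \<bar>\<theta>\<bar>"
      using that beta_bounds alpha by (intro cos_monotone_0_pi_le) auto
    ultimately show ?thesis by (auto simp: x_def intro!: divide_nonneg_nonneg mult_nonneg_nonneg)
  qed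
  then show "0 \<le> rho \<alpha> (1 / s) \<theta>"
    using s_pos by (auto simp: rho intro!: mult_nonneg_nonneg)
qed

text \<open>The potential of the constrained measure is the average over \<open>u \<in> [0, 1 / \<xi>]\<close> of the equilibrium
potentials of the arcs with half angle sines \<open>arc_radius \<alpha> u\<close>.\<close>

lemma has_integral_L:
  "((\<lambda>u. arc_potential (sin (\<phi> / 2)) (arc_radius \<alpha> u)) has_integral s * L \<phi> \<alpha> (1 / s)) {0..s}"
proof -
  define y where "y = sin (\<phi> / 2)"
  define h where "h = (\<lambda>u. arc_potential y (arc_radius \<alpha> u))"
  have [measurable]: "h \<in> borel_measurable borel" unfolding h_def by measurable
  have h_le: "h u \<le> ln 2" if "0 \<le> u" "u \<le> s" for u
    unfolding h_def using arc_radius_bounds[OF that] by (intro arc_potential_le_ln2) (auto simp: y_def)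
  define N where "N = (\<integral>\<^sup>+\<theta>. ennreal (log_kernel \<phi> \<theta>) * ennreal (s * rho \<alpha> (1 / s) \<theta>) *
    indicator {- \<alpha>..\<alpha>} \<theta> \<partial>lborel)"
  have N: "N = (\<integral>\<^sup>+u. ennreal (indicator {0..s} u * (ln 2 - h u)) \<partial>lborel)"
  proof -
    \<comment> \<open>At \<open>u = s\<close> the arc may degenerate to a point.\<close>
    have "AE u in lborel. u \<noteq> s" by (rule AE_lborel_singleton)
    then have "AE u in lborel. (\<integral>\<^sup>+\<theta>. ennreal (log_kernel \<phi> \<theta>) * ennreal (arc_density (arc_radius \<alpha> u) \<theta>) *
        indicator {- pi..pi} \<theta> \<partial>lborel) * indicator {0..s} u = ennreal (indicator {0..s} u * (ln 2 - h u))"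
    proof eventually_elim
      case (elim u)
      then show ?case
        using arc_radius_pos[of u] arc_radius_bounds[of u]
        by (cases "u \<in> {0..s}") (auto simp: nn_integral_log_kernel_arc_density h_def y_def)
    qed
    then show ?thesis unfolding N_def by (subst nn_integral_rho) (auto intro!: nn_integral_cong_AE)
  qed
  \<comment> \<open>Finiteness of \<open>N\<close>: the density is bounded by a multiple of the uniform density on the circle.\<close>
  have "N \<le> (\<integral>\<^sup>+\<theta>. ennreal (log_kernel \<phi> \<theta>) * ennreal (arc_density 1 \<theta>) * indicator {- pi..pi} \<theta> \<partial>lborel)"
    unfolding N_def
  proof (rule nn_integral_mono_AE)
    have "AE \<theta> in lborel. \<theta> \<noteq> pi" "AE \<theta> in lborel. \<theta> \<noteq> - pi" by (rule AE_lborel_singleton)+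
    then show "AE \<theta> in lborel. ennreal (log_kernel \<phi> \<theta>) * ennreal (s * rho \<alpha> (1 / s) \<theta>) * indicator {- \<alpha>..\<alpha>} \<theta> \<le>
        ennreal (log_kernel \<phi> \<theta>) * ennreal (arc_density 1 \<theta>) * indicator {- pi..pi} \<theta>"
    proof eventually_elim
      case (elim \<theta>)
      show ?case
      proof (cases "\<theta> \<in> {- \<alpha>..\<alpha>}")
        case True
        then have "\<bar>\<theta>\<bar> < pi" "\<bar>\<theta>\<bar> \<le> \<alpha>" using alpha elim by auto
        then have "s * rho \<alpha> (1 / s) \<theta> \<le> arc_density 1 \<theta>" using rho_bounds by (simp add: arc_density_full)
        then have "ennreal (s * rho \<alpha> (1 / s) \<theta>) \<le> ennreal (arc_density 1 \<theta>)" by (rule ennreal_leI)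
        then show ?thesis using True alpha by (auto intro!: mult_mono simp: indicator_def)
      qed simp
    qed
  qed
  also have "\<dots> < top" by (subst nn_integral_log_kernel_arc_density) auto
  finally have "N < top" .
  then obtain n where n: "N = ennreal n" "0 \<le> n" by (cases N) auto
  have mass: "(\<integral>\<^sup>+\<theta>. 1 * ennreal (s * rho \<alpha> (1 / s) \<theta>) * indicator {- \<alpha>..\<alpha>} \<theta> \<partial>lborel) = ennreal s"
  proof -
    have "AE u in lborel. u \<noteq> s" by (rule AE_lborel_singleton)
    then have "AE u in lborel. (\<integral>\<^sup>+\<theta>. 1 * ennreal (arc_density (arc_radius \<alpha> u) \<theta>) *
        indicator {- pi..pi} \<theta> \<partial>lborel) * indicator {0..s} u = indicator {0..s} u"
    proof eventually_elim
      case (elim u)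
      show ?case
      proof (cases "u \<in> {0..s}")
        case True
        then show ?thesis using elim arc_radius_pos[of u] arc_radius_bounds[of u]
          by (subst nn_integral_arc_density) (auto simp: ennreal_mult[symmetric])
      qed simp
    qed
    then have "(\<integral>\<^sup>+\<theta>. 1 * ennreal (s * rho \<alpha> (1 / s) \<theta>) * indicator {- \<alpha>..\<alpha>} \<theta> \<partial>lborel) =
        (\<integral>\<^sup>+u. indicator {0..s} u \<partial>lborel)"
      by (subst nn_integral_rho, simp, intro nn_integral_cong_AE)
    then show ?thesis using s_pos by simp
  qed
  have B1: "has_bochner_integral lborel (\<lambda>\<theta>. indicator {- \<alpha>..\<alpha>} \<theta> * (s * rho \<alpha> (1 / s) \<theta>)) s"
  proof (rule has_bochner_integral_nn_integral)
    show "AE \<theta> in lborel. 0 \<le> indicator {- \<alpha>..\<alpha>} \<theta> * (s * rho \<alpha> (1 / s) \<theta>)"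
      using rho_bounds(1) s_pos by (auto simp: indicator_def)
    show "(\<integral>\<^sup>+\<theta>. ennreal (indicator {- \<alpha>..\<alpha>} \<theta> * (s * rho \<alpha> (1 / s) \<theta>)) \<partial>lborel) = ennreal s"
      unfolding mass[symmetric] by (intro nn_integral_cong) (auto simp: indicator_def)
  qed (use s_pos in auto)
  have B2: "has_bochner_integral lborel
      (\<lambda>\<theta>. indicator {- \<alpha>..\<alpha>} \<theta> * (log_kernel \<phi> \<theta> * (s * rho \<alpha> (1 / s) \<theta>))) n"
  proof (rule has_bochner_integral_nn_integral)
    show "AE \<theta> in lborel. 0 \<le> indicator {- \<alpha>..\<alpha>} \<theta> * (log_kernel \<phi> \<theta> * (s * rho \<alpha> (1 / s) \<theta>))"
      using rho_bounds(1) s_pos log_kernel_nonneg by (auto simp: indicator_def)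
    show "(\<integral>\<^sup>+\<theta>. ennreal (indicator {- \<alpha>..\<alpha>} \<theta> * (log_kernel \<phi> \<theta> * (s * rho \<alpha> (1 / s) \<theta>))) \<partial>lborel) = ennreal n"
      unfolding n(1)[symmetric] N_def
      by (intro nn_integral_cong) (auto simp: indicator_def ennreal_mult' log_kernel_nonneg)
  qed (use n in auto)
  have "has_bochner_integral lborel (\<lambda>\<theta>. ln 2 * (indicator {- \<alpha>..\<alpha>} \<theta> * (s * rho \<alpha> (1 / s) \<theta>)) -
      indicator {- \<alpha>..\<alpha>} \<theta> * (log_kernel \<phi> \<theta> * (s * rho \<alpha> (1 / s) \<theta>))) (ln 2 * s - n)"
    by (intro has_bochner_integral_diff has_bochner_integral_mult_right B1 B2)
  also have "(\<lambda>\<theta>. ln 2 * (indicator {- \<alpha>..\<alpha>} \<theta> * (s * rho \<alpha> (1 / s) \<theta>)) -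
      indicator {- \<alpha>..\<alpha>} \<theta> * (log_kernel \<phi> \<theta> * (s * rho \<alpha> (1 / s) \<theta>))) =
      (\<lambda>\<theta>. s * (indicator {- \<alpha>..\<alpha>} \<theta> *\<^sub>R (ln (norm (cis \<phi> - cis \<theta>)) * rho \<alpha> (1 / s) \<theta>)))"
    by (auto simp: log_kernel_def algebra_simps)
  finally have "s * L \<phi> \<alpha> (1 / s) = ln 2 * s - n"
    unfolding L_def set_lebesgue_integral_def by (simp add: has_bochner_integral_iff)
  moreover have "((\<lambda>u. ln 2 - h u) has_integral n) {0..s}"
  proof -
    have "((\<lambda>u. indicator {0..s} u * (ln 2 - h u)) has_integral n) UNIV"
    proof (rule nn_integral_has_integral)
      show "\<And>u. 0 \<le> indicator {0..s} u * (ln 2 - h u)" using h_le by (auto simp: indicator_def)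
    qed (use N n in auto)
    also have "(\<lambda>u. indicator {0..s} u * (ln 2 - h u)) = (\<lambda>u. if u \<in> {0..s} then ln 2 - h u else 0)"
      by auto
    finally show ?thesis by (simp only: has_integral_restrict_UNIV)
  qed
  then have "((\<lambda>u. ln 2 - (ln 2 - h u)) has_integral s * ln 2 - n) {0..s}"
    using has_integral_const_real[of "ln 2 :: real" 0 s] s_pos by (intro has_integral_diff) simp_all
  ultimately show ?thesis by (simp add: h_def y_def mult.commute)
qed

end

section \<open>Monotonicity of equilibrium potentials and of averages\<close>

lemma arc_potential_minus [simp]: "arc_potential (- y) a = arc_potential y a"
  by (simp add: arc_potential_def)

lemma arc_potential_mono:
  assumes "\<bar>y\<bar> \<le> \<bar>z\<bar>" "0 < max \<bar>y\<bar> a"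
  shows "arc_potential y a \<le> arc_potential z a"
proof -
  have "y\<^sup>2 \<le> z\<^sup>2" using assms(1) by (simp add: abs_le_square_iff[symmetric])
  then have "sqrt (max 0 (y\<^sup>2 - a\<^sup>2)) \<le> sqrt (max 0 (z\<^sup>2 - a\<^sup>2))" by auto
  moreover have "max \<bar>y\<bar> a \<le> max \<bar>z\<bar> a" using assms(1) by auto
  moreover have "0 \<le> sqrt (max 0 (y\<^sup>2 - a\<^sup>2))" by simp
  ultimately show ?thesis using assms(2) unfolding arc_potential_def by (intro ln_mono) linarith+
qed

lemma arc_potential_strict_mono:
  assumes "\<bar>y\<bar> < \<bar>z\<bar>" "a < \<bar>z\<bar>" "0 < max \<bar>y\<bar> a"
  shows "arc_potential y a < arc_potential z a"
proof -
  have "y\<^sup>2 \<le> z\<^sup>2" using assms(1) by (simp add: abs_le_square_iff[symmetric])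
  then have "sqrt (max 0 (y\<^sup>2 - a\<^sup>2)) \<le> sqrt (max 0 (z\<^sup>2 - a\<^sup>2))" by auto
  moreover have "max \<bar>y\<bar> a < max \<bar>z\<bar> a" using assms by auto
  moreover have "0 \<le> sqrt (max 0 (y\<^sup>2 - a\<^sup>2))" by simp
  ultimately show ?thesis using assms(3) unfolding arc_potential_def by (intro ln_less_cancel_iff[THEN iffD2]) linarith+
qed

lemma arc_potential_radius_strict_antimono:
  assumes "0 \<le> a" "a < c" "c \<le> \<bar>y\<bar>"
  shows "arc_potential y c < arc_potential y a"
proof -
  have "a\<^sup>2 < c\<^sup>2" using assms by (intro power_strict_mono) auto
  moreover have "c\<^sup>2 \<le> y\<^sup>2" using assms power_mono[of c "\<bar>y\<bar>" 2] by simp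
  ultimately have root: "0 \<le> sqrt (y\<^sup>2 - c\<^sup>2)" "sqrt (y\<^sup>2 - c\<^sup>2) < sqrt (y\<^sup>2 - a\<^sup>2)" by auto
  have eq: "arc_potential y c = ln (\<bar>y\<bar> + sqrt (y\<^sup>2 - c\<^sup>2))" "arc_potential y a = ln (\<bar>y\<bar> + sqrt (y\<^sup>2 - a\<^sup>2))"
    using assms by (intro arc_potential_outside; linarith)+
  show ?thesis using assms root unfolding eq by (intro ln_less_cancel_iff[THEN iffD2]) linarith+
qed

text \<open>A modulus of continuity in \<open>y\<close> that is uniform in the radius.\<close>

lemma arc_potential_diff_le:
  assumes "0 < y" "y \<le> z"
  shows "arc_potential z a - arc_potential y a \<le> ((z - y) + sqrt (z\<^sup>2 - y\<^sup>2)) / y"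
proof -
  define E where "E = (\<lambda>y. max \<bar>y\<bar> a + sqrt (max 0 (y\<^sup>2 - a\<^sup>2)))"
  have E: "arc_potential y a = ln (E y)" for y by (simp add: E_def arc_potential_def)
  have "0 \<le> sqrt (max 0 (y\<^sup>2 - a\<^sup>2))" "0 \<le> sqrt (max 0 (z\<^sup>2 - a\<^sup>2))" by simp_all
  then have Ey: "y \<le> E y" "0 < E z" using assms unfolding E_def by linarith+
  have sq: "y\<^sup>2 \<le> z\<^sup>2" using assms by (intro power_mono) auto
  have "sqrt (max 0 (z\<^sup>2 - a\<^sup>2)) \<le> sqrt (max 0 (y\<^sup>2 - a\<^sup>2) + (z\<^sup>2 - y\<^sup>2))" using sq by auto
  also have "\<dots> \<le> sqrt (max 0 (y\<^sup>2 - a\<^sup>2)) + sqrt (z\<^sup>2 - y\<^sup>2)" using sq by (intro sqrt_add_le_add_sqrt) auto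
  finally have 1: "E z - E y \<le> (z - y) + sqrt (z\<^sup>2 - y\<^sup>2)" using assms by (auto simp: E_def)
  have "ln (E z) - ln (E y) = ln (E z / E y)" using Ey assms by (simp add: ln_div)
  also have "\<dots> \<le> E z / E y - 1" using Ey assms by (intro ln_le_minus_one) auto
  also have "\<dots> = (E z - E y) / E y" using Ey assms by (simp add: field_simps)
  also have "\<dots> \<le> ((z - y) + sqrt (z\<^sup>2 - y\<^sup>2)) / E y" using 1 Ey assms by (intro divide_right_mono) auto
  also have "\<dots> \<le> ((z - y) + sqrt (z\<^sup>2 - y\<^sup>2)) / y" using sq Ey assms by (intro divide_left_mono) auto
  finally show ?thesis by (simp add: E)
qed

lemma isCont_arc_potential:
  assumes "isCont f x" "isCont g x" "0 < max \<bar>f x\<bar> (g x)"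
  shows "isCont (\<lambda>x. arc_potential (f x) (g x)) (x :: real)"
proof -
  have "0 \<le> sqrt (max 0 ((f x)\<^sup>2 - (g x)\<^sup>2))" by simp
  with assms(3) have "max \<bar>f x\<bar> (g x) + sqrt (max 0 ((f x)\<^sup>2 - (g x)\<^sup>2)) \<noteq> 0" by linarith
  then show ?thesis unfolding arc_potential_def using assms(1,2) by (intro continuous_intros)
qed

lemma has_integral_less:
  fixes f g :: "real \<Rightarrow> real"
  assumes f: "(f has_integral I) {0..s}" and g: "(g has_integral J) {0..s}"
    and le: "\<And>u. 0 < u \<Longrightarrow> u < s \<Longrightarrow> f u \<le> g u"
    and m: "0 \<le> m" "m < m'" "m' \<le> s" and cont: "continuous_on {m..m'} f" "continuous_on {m..m'} g"
    and less: "\<And>u. m < u \<Longrightarrow> u < m' \<Longrightarrow> f u < g u"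
  shows "I < J"
proof -
  define h where "h = (\<lambda>u. if u \<in> {0, s} then 0 else g u - f u)"
  have "((\<lambda>u. g u - f u) has_integral J - I) {0..s}" by (intro has_integral_diff f g)
  then have h: "(h has_integral J - I) {0..s}"
    by (rule has_integral_spike_finite[where S = "{0, s}", rotated 2]) (auto simp: h_def)
  have hm: "h integrable_on {m..m'}"
    using m by (intro integrable_on_subinterval[OF has_integral_integrable[OF h]]) auto
  have "integral {m..m'} (\<lambda>u. 0) < integral {m..m'} (\<lambda>u. g u - f u)"
    using cont less m by (intro integral_less_real continuous_intros) auto
  also have "\<dots> = integral {m..m'} h"
    by (rule integral_spike[of "{0, s}"]) (auto simp: h_def)
  also have "\<dots> \<le> integral {0..s} h"
    using m h hm le by (intro integral_subset_le) (auto simp: h_def has_integral_integrable)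
  also have "\<dots> = J - I" using h by (rule integral_unique)
  finally show ?thesis by simp
qed

lemma has_integral_ge_const:
  fixes h :: "real \<Rightarrow> real"
  assumes h: "(h has_integral I) {p..q}" and "p \<le> q" and "\<And>u. p \<le> u \<Longrightarrow> u < q \<Longrightarrow> c \<le> h u"
  shows "c * (q - p) \<le> I"
proof -
  have "((\<lambda>u. if u = q then c else h u) has_integral I) {p..q}"
    using h by (rule has_integral_spike_finite[where S = "{q}", rotated 2]) auto
  from has_integral_le[OF _ this, of "\<lambda>u. c" "c * (q - p)"] has_integral_const_real[of c p q]
  show ?thesis using assms by (auto simp: mult.commute)
qed

lemma average_less:
  fixes h :: "real \<Rightarrow> real"
  assumes "0 < s" and h: "(h has_integral s * A) {0..s}" and "continuous_on {0..s} h"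
    and less: "\<And>u. 0 \<le> u \<Longrightarrow> u < s \<Longrightarrow> h u < h s"
  shows "A < h s"
proof -
  have "s * A < s * h s"
  proof (rule has_integral_less[OF h, of "\<lambda>u. h s" _ 0 s])
    show "((\<lambda>u. h s) has_integral s * h s) {0..s}"
      using has_integral_const_real[of "h s" 0 s] assms(1) by simp
  qed (use assms in \<open>auto intro: less_imp_le\<close>)
  then show ?thesis using assms(1) by simp
qed

text \<open>Once the running average of \<open>h\<close> lies below \<open>h\<close> and \<open>h\<close> increases from there on, the running
average is strictly increasing.\<close>

lemma average_strict_mono:
  fixes h :: "real \<Rightarrow> real"
  assumes s: "0 < r" "r \<le> s1" "s1 < s2"
    and A: "(h has_integral r * A) {0..r}" "A < h r"
    and A1: "(h has_integral s1 * A1) {0..s1}" and A2: "(h has_integral s2 * A2) {0..s2}"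
    and mono: "\<And>u v. r \<le> u \<Longrightarrow> u \<le> v \<Longrightarrow> v < s2 \<Longrightarrow> h u \<le> h v"
  shows "A1 < A2"
proof -
  have part: "(h has_integral q * B' - p * B) {p..q}"
    if "0 < p" "p \<le> q" "(h has_integral p * B) {0..p}" "(h has_integral q * B') {0..q}" for p q B B'
  proof -
    have "h integrable_on {p..q}"
      using that by (intro integrable_on_subinterval[OF has_integral_integrable[OF that(4)]]) auto
    then obtain i where i: "(h has_integral i) {p..q}" by blast
    have "p * B + i = q * B'"
      using has_integral_combine[OF _ _ that(3) i] that by (auto intro: has_integral_unique)
    then have "i = q * B' - p * B" by simp
    with i show ?thesis by simp
  qed
  have "((\<lambda>u. - h u) has_integral - (s1 * A1 - r * A)) {r..s1}"
    using s by (intro has_integral_neg part A A1)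
  then have "- h s1 * (s1 - r) \<le> - (s1 * A1 - r * A)"
    using s mono by (elim has_integral_ge_const) auto
  moreover have "r * A < r * h r" "r * h r \<le> r * h s1" using s A(2) mono[of r s1] by auto
  ultimately have "s1 * A1 < s1 * h s1" by (simp add: algebra_simps)
  then have lt: "A1 < h s1" using s by simp
  have "h s1 * (s2 - s1) \<le> s2 * A2 - s1 * A1"
    using s mono by (intro has_integral_ge_const[OF part[OF _ _ A1 A2]]) auto
  moreover have "A1 * (s2 - s1) < h s1 * (s2 - s1)" using lt s by (intro mult_strict_right_mono) auto
  ultimately have "s2 * A1 < s2 * A2" by (simp add: algebra_simps)
  then show ?thesis using s by simp
qed

section \<open>The rescaled potential as a function of the point\<close>

text \<open>Admissible pairs \<open>(b, \<xi>)\<close>: the unscaled parameters are \<open>\<alpha> = pi / b\<close> and \<open>b \<xi>\<close>.\<close>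

locale rescaled =
  fixes b \<xi> :: real
  assumes b: "1 \<le> b" and xi: "1 \<le> \<xi>" and not_one: "(b, \<xi>) \<noteq> (1, 1)"
begin

lemma arc_parameters_rescaled: "arc_parameters (pi / b) (1 / (b * \<xi>))"
proof
  have "1 < b * \<xi>"
  proof (cases "b = 1")
    case True
    then show ?thesis using xi not_one by auto
  next
    case False
    then have "1 * 1 < b * \<xi>" using b xi by (intro mult_less_le_imp_less) auto
    then show ?thesis by simp
  qed
  then show "0 < 1 / (b * \<xi>)" "1 / (b * \<xi>) < 1" by auto
qed (use b xi in \<open>auto simp: field_simps\<close>)

sublocale arc_parameters "pi / b" "1 / (b * \<xi>)" by (rule arc_parameters_rescaled)

lemma has_integral_L_tilde:
  "((\<lambda>u. arc_potential (sin (pi * x / b)) (arc_radius (pi / b) u)) has_integral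
    1 / (b * \<xi>) * L_tilde x b \<xi>) {0..1 / (b * \<xi>)}"
  using has_integral_L[of "2 * pi * x / b"] b xi by (simp add: L_tilde_def)

lemma beta_tilde_bounds: "0 \<le> beta_tilde b \<xi>" "beta_tilde b \<xi> \<le> 1 / 2"
  using beta_bounds b by (auto simp: beta_tilde_def field_simps)

lemma arc_radius_beta_tilde: "arc_radius (pi / b) (1 / (b * \<xi>)) = sin (pi * beta_tilde b \<xi> / b)"
  using sin_half_beta b by (simp add: beta_tilde_def)

lemma L_tilde_minus: "L_tilde (- x) b \<xi> = L_tilde x b \<xi>"
proof -
  have "((\<lambda>u. arc_potential (sin (pi * x / b)) (arc_radius (pi / b) u)) has_integral
      1 / (b * \<xi>) * L_tilde (- x) b \<xi>) {0..1 / (b * \<xi>)}"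
    using has_integral_L_tilde[of "- x"] by simp
  then have "1 / (b * \<xi>) * L_tilde (- x) b \<xi> = 1 / (b * \<xi>) * L_tilde x b \<xi>"
    using has_integral_L_tilde[of x] by (rule has_integral_unique)
  then show ?thesis using b xi by simp
qed

lemma L_tilde_abs: "L_tilde \<bar>x\<bar> b \<xi> = L_tilde x b \<xi>"
  by (simp add: abs_if L_tilde_minus)

end

lemma sin_scale:
  fixes x z b :: real
  assumes "1 \<le> b" "\<bar>x\<bar> \<le> 1 / 2" "\<bar>z\<bar> \<le> 1 / 2"
  shows "\<bar>x\<bar> \<le> \<bar>z\<bar> \<Longrightarrow> \<bar>sin (pi * x / b)\<bar> \<le> \<bar>sin (pi * z / b)\<bar>"
    and "\<bar>x\<bar> < \<bar>z\<bar> \<Longrightarrow> \<bar>sin (pi * x / b)\<bar> < \<bar>sin (pi * z / b)\<bar>"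
proof -
  have range: "0 \<le> pi * \<bar>v\<bar> / b \<and> pi * \<bar>v\<bar> / b \<le> pi / 2" if "\<bar>v\<bar> \<le> 1 / 2" for v
  proof -
    have "pi * \<bar>v\<bar> * 1 \<le> pi * (1 / 2) * b" using that assms(1) by (intro mult_mono) auto
    then show ?thesis using assms(1) by (simp add: field_simps)
  qed
  have eq: "\<bar>sin (pi * v / b)\<bar> = sin (pi * \<bar>v\<bar> / b)" if "\<bar>v\<bar> \<le> 1 / 2" for v
  proof -
    have "0 \<le> sin (pi * \<bar>v\<bar> / b)" using range[OF that] pi_gt_zero by (intro sin_ge_zero) linarith+
    then show ?thesis by (auto simp: abs_if split: if_splits)
  qed
  show "\<bar>sin (pi * x / b)\<bar> \<le> \<bar>sin (pi * z / b)\<bar>" if "\<bar>x\<bar> \<le> \<bar>z\<bar>"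
  proof -
    have "pi * \<bar>x\<bar> / b \<le> pi * \<bar>z\<bar> / b" using that assms(1) by (intro divide_right_mono mult_left_mono) auto
    then have "sin (pi * \<bar>x\<bar> / b) \<le> sin (pi * \<bar>z\<bar> / b)"
      using range[OF assms(2)] range[OF assms(3)] by (intro sin_monotone_2pi_le) auto
    then show ?thesis using eq assms by simp
  qed
  show "\<bar>sin (pi * x / b)\<bar> < \<bar>sin (pi * z / b)\<bar>" if "\<bar>x\<bar> < \<bar>z\<bar>"
  proof -
    have "pi * \<bar>x\<bar> / b < pi * \<bar>z\<bar> / b" using that assms(1) by (intro divide_strict_right_mono mult_strict_left_mono) auto
    then have "sin (pi * \<bar>x\<bar> / b) < sin (pi * \<bar>z\<bar> / b)"
      using range[OF assms(2)] range[OF assms(3)] by (intro sin_monotone_2pi) auto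
    then show ?thesis using eq assms by simp
  qed
qed

context arc_parameters
begin

lemma arc_radius_antimono:
  assumes "0 \<le> u" "u \<le> v" "v \<le> s"
  shows "arc_radius \<alpha> v \<le> arc_radius \<alpha> u"
proof -
  have "cos (pi * v / 2) \<le> cos (pi * u / 2)"
    using assms half_angle_bounds[of u] half_angle_bounds[of v] by (intro cos_monotone_0_pi_le) (auto intro: mult_left_mono)
  then have "cos (\<alpha> / 2) / cos (pi * u / 2) \<le> cos (\<alpha> / 2) / cos (pi * v / 2)"
    using cos_angle[of u] cos_angle[of v] assms by (intro divide_left_mono mult_pos_pos) auto
  then have "(cos (\<alpha> / 2) / cos (pi * u / 2))\<^sup>2 \<le> (cos (\<alpha> / 2) / cos (pi * v / 2))\<^sup>2"
    using cos_ratio_bounds[of u] assms by (intro power_mono) auto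
  then show ?thesis by (simp add: arc_radius_def del: power_divide)
qed

lemma arc_radius_strict_antimono:
  assumes "0 \<le> u" "u < v" "v \<le> s" "\<alpha> < pi"
  shows "arc_radius \<alpha> v < arc_radius \<alpha> u"
proof -
  have "cos (pi * v / 2) < cos (pi * u / 2)"
    using assms half_angle_bounds[of u] half_angle_bounds[of v] by (intro cos_monotone_0_pi) auto
  moreover have "0 < cos (\<alpha> / 2)" using alpha assms by (intro cos_gt_zero_pi) auto
  ultimately have "cos (\<alpha> / 2) / cos (pi * u / 2) < cos (\<alpha> / 2) / cos (pi * v / 2)"
    using cos_angle[of u] cos_angle[of v] assms by (intro divide_strict_left_mono mult_pos_pos) auto
  then have "(cos (\<alpha> / 2) / cos (pi * u / 2))\<^sup>2 < (cos (\<alpha> / 2) / cos (pi * v / 2))\<^sup>2"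
    using cos_ratio_bounds[of u] assms by (intro power_strict_mono) auto
  then show ?thesis by (simp add: arc_radius_def del: power_divide)
qed

lemma isCont_arc_radius: "0 \<le> u \<Longrightarrow> u \<le> s \<Longrightarrow> isCont (arc_radius \<alpha>) u"
  using cos_angle(1)[of u] unfolding arc_radius_def by (intro continuous_intros) auto

lemma isCont_arc_potential_radius:
  "0 \<le> u \<Longrightarrow> u \<le> s \<Longrightarrow> 0 < max \<bar>y\<bar> (arc_radius \<alpha> u) \<Longrightarrow> isCont (\<lambda>u. arc_potential y (arc_radius \<alpha> u)) u"
  by (intro isCont_arc_potential isCont_arc_radius) auto

end

context rescaled
begin

text \<open>A point of the smallest arc of the mixture lies in all of its arcs, and there their potentials are
the logarithms of their capacities.\<close>

lemma L_tilde_constant: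
  assumes "\<bar>x\<bar> \<le> beta_tilde b \<xi>"
  shows "((\<lambda>u. ln (arc_radius (pi / b) u)) has_integral 1 / (b * \<xi>) * L_tilde x b \<xi>) {0..1 / (b * \<xi>)}"
proof (rule has_integral_eq[OF _ has_integral_L_tilde[of x]])
  fix u assume u: "u \<in> {0..1 / (b * \<xi>)}"
  have "\<bar>sin (pi * x / b)\<bar> \<le> \<bar>sin (pi * beta_tilde b \<xi> / b)\<bar>"
    using assms beta_tilde_bounds b by (intro sin_scale(1)) auto
  also have "\<dots> = arc_radius (pi / b) (1 / (b * \<xi>))"
    using arc_radius_beta_tilde arc_radius_bounds(1)[of "1 / (b * \<xi>)"] s_pos by simp
  also have "\<dots> \<le> arc_radius (pi / b) u" using u by (intro arc_radius_antimono) auto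
  finally show "arc_potential (sin (pi * x / b)) (arc_radius (pi / b) u) = ln (arc_radius (pi / b) u)"
    by (rule arc_potential_inside)
qed

lemma L_tilde_mono:
  assumes "\<bar>x\<bar> \<le> \<bar>z\<bar>" "\<bar>z\<bar> \<le> 1 / 2"
  shows "L_tilde x b \<xi> \<le> L_tilde z b \<xi>"
proof -
  let ?s = "1 / (b * \<xi>)"
  let ?h = "\<lambda>x u. arc_potential (sin (pi * x / b)) (arc_radius (pi / b) u)"
  have y: "\<bar>sin (pi * x / b)\<bar> \<le> \<bar>sin (pi * z / b)\<bar>" using assms b by (intro sin_scale(1)) auto
  have "((\<lambda>u. ?h z u - ?h x u) has_integral ?s * L_tilde z b \<xi> - ?s * L_tilde x b \<xi>) {0..?s}"
    by (intro has_integral_diff has_integral_L_tilde)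
  then have "0 * (?s - 0) \<le> ?s * L_tilde z b \<xi> - ?s * L_tilde x b \<xi>"
  proof (rule has_integral_ge_const)
    fix u assume "0 \<le> u" "u < ?s"
    then have "0 < arc_radius (pi / b) u" by (rule arc_radius_pos)
    then show "0 \<le> ?h z u - ?h x u" using arc_potential_mono[OF y, of "arc_radius (pi / b) u"] by simp
  qed (use s_pos in simp)
  then have "?s * L_tilde x b \<xi> \<le> ?s * L_tilde z b \<xi>" by simp
  then show ?thesis using s_pos by (simp only: mult_le_cancel_left_pos)
qed

text \<open>Only the arcs with parameter \<open>u\<close> close to \<open>1 / (b \<xi>)\<close> need miss the point \<open>z\<close>; these make the
inequality strict.\<close>

lemma L_tilde_strict_mono:
  assumes "beta_tilde b \<xi> \<le> x" "x < z" "z \<le> 1 / 2"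
  shows "L_tilde x b \<xi> < L_tilde z b \<xi>"
proof -
  let ?s = "1 / (b * \<xi>)"
  let ?a = "arc_radius (pi / b)"
  define y1 y2 where "y1 = sin (pi * x / b)" and "y2 = sin (pi * z / b)"
  have x: "0 \<le> x" using assms beta_tilde_bounds by simp
  have y: "\<bar>y1\<bar> < \<bar>y2\<bar>" unfolding y1_def y2_def using assms x b by (intro sin_scale(2)) auto
  have "\<bar>sin (pi * beta_tilde b \<xi> / b)\<bar> < \<bar>y2\<bar>"
    unfolding y2_def using assms beta_tilde_bounds b by (intro sin_scale(2)) auto
  then have s: "?a ?s < \<bar>y2\<bar>" unfolding arc_radius_beta_tilde by simp
  have "(?a \<longlongrightarrow> ?a ?s) (at ?s)"
    using isCont_arc_radius[of ?s] s_pos by (simp add: isCont_def)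
  then have "\<forall>\<^sub>F u in at ?s. ?a u < \<bar>y2\<bar>" using s by (rule order_tendstoD)
  then obtain d where d: "0 < d" "\<And>u. u \<noteq> ?s \<Longrightarrow> dist u ?s < d \<Longrightarrow> ?a u < \<bar>y2\<bar>"
    by (auto simp: eventually_at)
  define m where "m = max 0 (?s - d)"
  have "0 \<le> m" "m < ?s" using s_pos d(1) by (simp_all add: m_def)
  moreover from this(2) obtain m' where "m < m'" "m' < ?s" using dense by blast
  ultimately have m: "0 \<le> m" "m < m'" "m' < ?s" by blast+
  have cont: "continuous_on {m..m'} (\<lambda>u. arc_potential y (?a u))" for y
    using m arc_radius_pos
    by (intro continuous_at_imp_continuous_on ballI isCont_arc_potential_radius) (auto simp: less_max_iff_disj)
  have "?s * L_tilde x b \<xi> < ?s * L_tilde z b \<xi>"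
  proof (rule has_integral_less[OF has_integral_L_tilde has_integral_L_tilde _ m(1,2)], fold y1_def y2_def)
    show "arc_potential y1 (?a u) \<le> arc_potential y2 (?a u)" if "0 < u" "u < ?s" for u
      using that y arc_radius_pos[of u] by (intro arc_potential_mono) auto
    show "arc_potential y1 (?a u) < arc_potential y2 (?a u)" if "m < u" "u < m'" for u
      using that y m d arc_radius_pos[of u] by (intro arc_potential_strict_mono d(2)) (auto simp: dist_real_def m_def)
  qed (use m cont in auto)
  then show ?thesis using s_pos by (simp only: mult_less_cancel_left_pos)
qed

end

section \<open>Dependence on the parameter\<close>

lemma eventually_less_isCont:
  fixes f :: "real \<Rightarrow> real"
  assumes "isCont f x" "c < f x"
  shows "\<forall>\<^sub>F z in nhds x. c < f z"
  using assms tendsto_at_iff_tendsto_nhds[of f x] order_tendstoD(1)[of f "f x" "nhds x" c]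
  by (simp add: isCont_def)

text \<open>For \<open>b > 1\<close> all \<open>\<xi> \<ge> 1\<close> are admissible, and all averages are over subintervals of \<open>[0, 1 / b]\<close>.\<close>

locale proper_scale =
  fixes b :: real
  assumes b: "1 < b"
begin

sublocale arc_parameters "pi / b" "1 / b"
  by unfold_locales (use b in \<open>auto simp: field_simps\<close>)

lemma rescaled: "1 \<le> \<xi> \<Longrightarrow> rescaled b \<xi>"
  by unfold_locales (use b in auto)

abbreviation radius :: "real \<Rightarrow> real" where "radius \<equiv> arc_radius (pi / b)"

abbreviation potential :: "real \<Rightarrow> real \<Rightarrow> real" where
  "potential x u \<equiv> arc_potential (sin (pi * x / b)) (radius u)"

lemma inverse_range: "1 \<le> \<xi> \<Longrightarrow> 0 < 1 / (b * \<xi>)" "1 \<le> \<xi> \<Longrightarrow> 1 / (b * \<xi>) \<le> 1 / b"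
  using b by (auto intro!: divide_left_mono)

lemma inverse_less: "1 \<le> \<xi> \<Longrightarrow> \<xi> < \<zeta> \<Longrightarrow> 1 / (b * \<zeta>) < 1 / (b * \<xi>)"
  using b by (intro divide_strict_left_mono) auto

lemma sin_endpoint: "0 < sin (pi * (1 / 2) / b)" "sin (pi * (1 / 2) / b) < 1" "radius 0 = sin (pi * (1 / 2) / b)"
proof -
  have r: "0 < pi * (1 / 2) / b" "pi * (1 / 2) / b < pi / 2" using b by (auto simp: field_simps)
  then show s: "0 < sin (pi * (1 / 2) / b)" by (intro sin_gt_zero) auto
  have "sin (pi * (1 / 2) / b) < sin (pi / 2)" using r by (intro sin_monotone_2pi) auto
  then show "sin (pi * (1 / 2) / b) < 1" by simp
  have "radius 0 = sqrt ((sin (pi * (1 / 2) / b))\<^sup>2)" 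
    by (simp add: arc_radius_def sin_squared_eq mult.commute)
  then show "radius 0 = sin (pi * (1 / 2) / b)" using s by simp
qed

lemma radius_less: "0 \<le> u \<Longrightarrow> u < v \<Longrightarrow> v \<le> 1 / b \<Longrightarrow> radius v < radius u"
  using b by (intro arc_radius_strict_antimono) (auto simp: field_simps)

lemma radius_le_endpoint: "0 \<le> u \<Longrightarrow> u \<le> 1 / b \<Longrightarrow> radius u \<le> sin (pi * (1 / 2) / b)"
  using arc_radius_antimono[of 0 u] sin_endpoint by simp

lemma potential_less:
  assumes "0 \<le> u" "u < v" "v \<le> 1 / b" "radius u \<le> \<bar>sin (pi * x / b)\<bar>"
  shows "potential x u < potential x v"
  using assms radius_less[of u v] arc_radius_bounds(1)[of v] by (intro arc_potential_radius_strict_antimono) auto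

lemma L_tilde_endpoint_less:
  assumes "1 \<le> \<xi>"
  shows "L_tilde (1 / 2) b \<xi> < potential (1 / 2) (1 / (b * \<xi>))"
proof (rule average_less[OF inverse_range(1)[OF assms] rescaled.has_integral_L_tilde[OF rescaled[OF assms]]])
  show "continuous_on {0..1 / (b * \<xi>)} (potential (1 / 2))"
    using inverse_range[OF assms] sin_endpoint
    by (intro continuous_at_imp_continuous_on ballI isCont_arc_potential_radius) (auto simp: less_max_iff_disj)
  show "potential (1 / 2) u < potential (1 / 2) (1 / (b * \<xi>))" if "0 \<le> u" "u < 1 / (b * \<xi>)" for u
    using that inverse_range[OF assms] radius_le_endpoint[of u] sin_endpoint by (intro potential_less) auto
qed

text \<open>Once the arc has left the point \<open>x\<close>, the potential there increases as the arc shrinks.  Hence the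
average is monotone from any \<open>\<omega>\<close> on at which it lies below the current potential.\<close>

lemma L_tilde_decreasing:
  assumes "1 \<le> \<xi>" "\<xi> < \<zeta>" "\<zeta> \<le> \<omega>"
    and avg: "L_tilde x b \<omega> < potential x (1 / (b * \<omega>))"
    and x: "radius (1 / (b * \<omega>)) \<le> \<bar>sin (pi * x / b)\<bar>"
  shows "L_tilde x b \<zeta> < L_tilde x b \<xi>"
proof (rule average_strict_mono)
  have 1: "1 \<le> \<xi>" "1 \<le> \<zeta>" "1 \<le> \<omega>" using assms by auto
  show "0 < 1 / (b * \<omega>)" using inverse_range 1 by simp
  show "1 / (b * \<omega>) \<le> 1 / (b * \<zeta>)" using inverse_less[of \<zeta> \<omega>] assms by (cases "\<zeta> = \<omega>") auto
  show "1 / (b * \<zeta>) < 1 / (b * \<xi>)" using inverse_less assms by simp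
  show "(potential x has_integral 1 / (b * \<omega>) * L_tilde x b \<omega>) {0..1 / (b * \<omega>)}"
    "(potential x has_integral 1 / (b * \<zeta>) * L_tilde x b \<zeta>) {0..1 / (b * \<zeta>)}"
    "(potential x has_integral 1 / (b * \<xi>) * L_tilde x b \<xi>) {0..1 / (b * \<xi>)}"
    using rescaled.has_integral_L_tilde[OF rescaled] 1 by blast+
  show "potential x u \<le> potential x v" if "1 / (b * \<omega>) \<le> u" "u \<le> v" "v < 1 / (b * \<xi>)" for u v
  proof (cases "u = v")
    case False
    have "0 \<le> u" "u \<le> 1 / b" "v \<le> 1 / b" using that inverse_range[OF 1(1)] inverse_range[OF 1(3)] by linarith+
    moreover have "radius u \<le> radius (1 / (b * \<omega>))"
      using that inverse_range[OF 1(3)] \<open>u \<le> 1 / b\<close> by (intro arc_radius_antimono) auto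
    ultimately show ?thesis using False that x by (intro less_imp_le[OF potential_less]) auto
  qed simp
qed (rule avg)

lemma L_tilde_endpoint_decreasing:
  assumes "1 \<le> \<xi>" "\<xi> < \<zeta>"
  shows "L_tilde (1 / 2) b \<zeta> < L_tilde (1 / 2) b \<xi>"
  using assms inverse_range[of \<zeta>] radius_le_endpoint[of "1 / (b * \<zeta>)"] sin_endpoint
  by (intro L_tilde_decreasing[OF assms order_refl] L_tilde_endpoint_less) auto

lemma isCont_sin_scale: "isCont (\<lambda>x. sin (pi * x / b)) x"
  using b by (intro continuous_intros) auto

lemma L_tilde_near_endpoint_decreasing:
  assumes "1 < \<xi>\<^sub>0"
  shows "\<exists>\<delta>>0. \<forall>x. 1 / 2 - \<delta> < \<bar>x\<bar> \<and> \<bar>x\<bar> \<le> 1 / 2 \<longrightarrow>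
    (\<exists>\<epsilon>>0. strict_antimono_on ({\<xi>\<^sub>0 - \<epsilon><..<\<xi>\<^sub>0 + \<epsilon>} \<inter> {1<..}) (\<lambda>\<xi>. L_tilde x b \<xi>))"
proof -
  \<comment> \<open>Any \<open>\<omega> > \<xi>\<^sub>0\<close> would do: at \<open>\<omega>\<close> the average lies strictly below the current potential at the
    endpoint, hence also near it, and monotonicity propagates to all \<open>\<xi> < \<omega>\<close>.\<close>
  define \<omega> where "\<omega> = 2 * \<xi>\<^sub>0"
  define r where "r = 1 / (b * \<omega>)"
  have \<omega>: "1 \<le> \<omega>" using assms by (simp add: \<omega>_def)
  have r: "0 < r" "r \<le> 1 / b" unfolding r_def using inverse_range[OF \<omega>] .
  have "radius r < sin (pi * (1 / 2) / b)" using radius_less[of 0 r] r sin_endpoint by simp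
  then have 1: "\<forall>\<^sub>F x in nhds (1 / 2). radius r < sin (pi * x / b)"
    by (rule eventually_less_isCont[OF isCont_sin_scale])
  have "isCont (\<lambda>x. arc_potential (sin (pi * x / b)) (radius r)) (1 / 2)"
    using sin_endpoint by (intro isCont_arc_potential isCont_sin_scale) (auto simp: less_max_iff_disj)
  moreover have "L_tilde (1 / 2) b \<omega> < potential (1 / 2) r" unfolding r_def by (rule L_tilde_endpoint_less[OF \<omega>])
  ultimately have 2: "\<forall>\<^sub>F x in nhds (1 / 2). L_tilde (1 / 2) b \<omega> < potential x r"
    by (rule eventually_less_isCont)
  from eventually_conj[OF 1 2] obtain \<delta> where \<delta>: "0 < \<delta>"
    "\<And>x. dist x (1 / 2) < \<delta> \<Longrightarrow> radius r < sin (pi * x / b) \<and> L_tilde (1 / 2) b \<omega> < potential x r"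
    by (auto simp: eventually_nhds_metric)
  have "strict_antimono_on ({\<xi>\<^sub>0 - \<xi>\<^sub>0<..<\<xi>\<^sub>0 + \<xi>\<^sub>0} \<inter> {1<..}) (\<lambda>\<xi>. L_tilde x b \<xi>)"
    if x: "1 / 2 - \<delta> < \<bar>x\<bar>" "\<bar>x\<bar> \<le> 1 / 2" for x
  proof (rule monotone_onI)
    fix \<xi> \<zeta> assume *: "\<xi> \<in> {\<xi>\<^sub>0 - \<xi>\<^sub>0<..<\<xi>\<^sub>0 + \<xi>\<^sub>0} \<inter> {1<..}" "\<zeta> \<in> {\<xi>\<^sub>0 - \<xi>\<^sub>0<..<\<xi>\<^sub>0 + \<xi>\<^sub>0} \<inter> {1<..}" "\<xi> < \<zeta>"
    have near: "radius r < sin (pi * \<bar>x\<bar> / b)" "L_tilde (1 / 2) b \<omega> < potential \<bar>x\<bar> r"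
      using \<delta>(2)[of "\<bar>x\<bar>"] x by (auto simp: dist_real_def)
    have "L_tilde \<bar>x\<bar> b \<omega> \<le> L_tilde (1 / 2) b \<omega>"
      using x by (intro rescaled.L_tilde_mono rescaled \<omega>) auto
    with near have "L_tilde \<bar>x\<bar> b \<zeta> < L_tilde \<bar>x\<bar> b \<xi>"
      using * by (intro L_tilde_decreasing[of \<xi> \<zeta> \<omega>]) (auto simp: r_def \<omega>_def)
    then show "L_tilde x b \<zeta> < L_tilde x b \<xi>"
      using * by (simp add: rescaled.L_tilde_abs rescaled)
  qed
  then show ?thesis using \<delta>(1) assms by (intro exI[of _ \<delta>] conjI allI impI exI[of _ \<xi>\<^sub>0]) auto
qed

lemma isCont_ln_radius: "0 \<le> u \<Longrightarrow> u < 1 / b \<Longrightarrow> isCont (\<lambda>u. ln (radius u)) u"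
  using arc_radius_pos[of u] isCont_arc_radius[of u] by (intro continuous_intros) auto

text \<open>On the smallest arc the potentials \<open>ln (radius u)\<close> decrease in \<open>u\<close>, so the same criterion applies
to their negatives.\<close>

lemma L_tilde_inside_increasing:
  assumes "1 \<le> \<xi>" "\<xi> < \<zeta>" and in1: "\<bar>x\<bar> \<le> beta_tilde b \<xi>" and in2: "\<bar>x\<bar> \<le> beta_tilde b \<zeta>"
  shows "L_tilde x b \<xi> < L_tilde x b \<zeta>"
proof -
  let ?h = "\<lambda>u. - ln (radius u)"
  have 1: "1 \<le> \<xi>" "1 \<le> \<zeta>" using assms by auto
  have less: "?h u < ?h v" if "0 \<le> u" "u < v" "v < 1 / b" for u v
    using radius_less[of u v] arc_radius_pos[of v] that by simp
  have lt: "1 / (b * \<zeta>) < 1 / (b * \<xi>)" using inverse_less assms by simp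
  have H: "(?h has_integral 1 / (b * \<eta>) * - L_tilde x b \<eta>) {0..1 / (b * \<eta>)}"
    if "1 \<le> \<eta>" "\<bar>x\<bar> \<le> beta_tilde b \<eta>" for \<eta>
    using has_integral_neg[OF rescaled.L_tilde_constant[OF rescaled that(2)]] that by simp
  have "- L_tilde x b \<zeta> < - L_tilde x b \<xi>"
  proof (rule average_strict_mono[OF inverse_range(1) order_refl lt H _ H H])
    show "- L_tilde x b \<zeta> < ?h (1 / (b * \<zeta>))"
    proof (rule average_less[OF inverse_range(1) H])
      show "continuous_on {0..1 / (b * \<zeta>)} ?h"
        using lt inverse_range[OF 1(1)]
        by (intro continuous_intros continuous_at_imp_continuous_on ballI isCont_ln_radius) auto
    qed (use 1 in2 less lt inverse_range[OF 1(1)] in auto)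
    show "?h u \<le> ?h v" if "1 / (b * \<zeta>) \<le> u" "u \<le> v" "v < 1 / (b * \<xi>)" for u v
    proof (cases "u = v")
      case False
      then have "?h u < ?h v" using that inverse_range[OF 1(1)] inverse_range[OF 1(2)] by (intro less) linarith+
      then show ?thesis by simp
    qed simp
  qed (use 1 in1 in2 in auto)
  then show ?thesis by simp
qed

lemma inverse_tendsto_0: "((\<lambda>\<xi>. 1 / (b * \<xi>)) \<longlongrightarrow> 0) at_top"
  using b by real_asymp

lemma tendsto_radius: "((\<lambda>\<xi>. radius (1 / (b * \<xi>))) \<longlongrightarrow> sin (pi * (1 / 2) / b)) at_top"
proof -
  have "isCont radius 0" using b by (intro isCont_arc_radius) auto
  from isCont_tendsto_compose[OF this inverse_tendsto_0] show ?thesis by (simp only: sin_endpoint)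
qed

lemma beta_tilde_arcsin:
  assumes "1 \<le> \<xi>"
  shows "beta_tilde b \<xi> = b / pi * arcsin (radius (1 / (b * \<xi>)))"
proof -
  interpret R: rescaled b \<xi> by (rule rescaled[OF assms])
  have "0 \<le> pi * beta_tilde b \<xi> / b" using R.beta_tilde_bounds b by simp
  moreover have "pi * beta_tilde b \<xi> * 1 \<le> pi * (1 / 2) * b"
    using R.beta_tilde_bounds b by (intro mult_mono) auto
  then have "pi * beta_tilde b \<xi> / b \<le> pi / 2" using b by (simp add: field_simps)
  ultimately have "arcsin (sin (pi * beta_tilde b \<xi> / b)) = pi * beta_tilde b \<xi> / b"
    using pi_gt_zero by (intro arcsin_sin) linarith+
  then show ?thesis using b by (simp add: R.arc_radius_beta_tilde)
qed

lemma tendsto_beta_tilde: "(beta_tilde b \<longlongrightarrow> 1 / 2) at_top"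
proof -
  have "isCont arcsin (sin (pi * (1 / 2) / b))" using sin_endpoint by (intro isCont_arcsin) auto
  from isCont_tendsto_compose[OF this tendsto_radius]
  have "((\<lambda>\<xi>. b / pi * arcsin (radius (1 / (b * \<xi>)))) \<longlongrightarrow> b / pi * arcsin (sin (pi * (1 / 2) / b))) at_top"
    by (rule tendsto_mult_left)
  moreover have "arcsin (sin (pi * (1 / 2) / b)) = pi * (1 / 2) / b"
  proof (rule arcsin_sin)
    have "0 \<le> pi * (1 / 2) / b" using b by simp
    then show "- (pi / 2) \<le> pi * (1 / 2) / b" using pi_gt_zero by linarith
    show "pi * (1 / 2) / b \<le> pi / 2" using b by (simp add: field_simps)
  qed
  ultimately have "((\<lambda>\<xi>. b / pi * arcsin (radius (1 / (b * \<xi>)))) \<longlongrightarrow> 1 / 2) at_top" using b by simp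
  moreover have "\<forall>\<^sub>F \<xi> in at_top. b / pi * arcsin (radius (1 / (b * \<xi>))) = beta_tilde b \<xi>"
    using eventually_ge_at_top[of 1] by eventually_elim (simp add: beta_tilde_arcsin)
  ultimately show ?thesis by (rule Lim_transform_eventually)
qed

lemma beta_tilde_mono:
  assumes "1 \<le> \<xi>" "\<xi> \<le> \<zeta>"
  shows "beta_tilde b \<xi> \<le> beta_tilde b \<zeta>"
proof -
  have z: "1 \<le> \<zeta>" using assms by simp
  have "1 / (b * \<zeta>) \<le> 1 / (b * \<xi>)" using assms b by (intro divide_left_mono) auto
  then have "radius (1 / (b * \<xi>)) \<le> radius (1 / (b * \<zeta>))"
    using inverse_range[OF z] inverse_range[OF assms(1)] by (intro arc_radius_antimono) auto
  moreover have "0 \<le> radius (1 / (b * \<xi>))" "radius (1 / (b * \<zeta>)) \<le> 1"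
    using inverse_range[OF z] inverse_range[OF assms(1)] by (auto intro!: arc_radius_bounds)
  ultimately have "arcsin (radius (1 / (b * \<xi>))) \<le> arcsin (radius (1 / (b * \<zeta>)))"
    by (intro arcsin_le_arcsin) auto
  then show ?thesis using b assms z by (simp add: beta_tilde_arcsin divide_right_mono mult_left_mono)
qed

lemma tendsto_L_tilde_inside:
  assumes "1 \<le> \<zeta>" "\<bar>x\<bar> \<le> beta_tilde b \<zeta>"
  shows "((\<lambda>\<xi>. L_tilde x b \<xi>) \<longlongrightarrow> ln (sin (pi * (1 / 2) / b))) at_top"
proof (rule tendsto_sandwich)
  show "((\<lambda>\<xi>. ln (radius (1 / (b * \<xi>)))) \<longlongrightarrow> ln (sin (pi * (1 / 2) / b))) at_top"
    using sin_endpoint by (intro tendsto_ln tendsto_radius) auto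
  have both: "ln (radius (1 / (b * \<xi>))) \<le> L_tilde x b \<xi> \<and> L_tilde x b \<xi> \<le> ln (sin (pi * (1 / 2) / b))"
    if \<xi>: "max \<zeta> 2 \<le> \<xi>" for \<xi>
  proof -
    have 1: "1 \<le> \<xi>" "\<zeta> \<le> \<xi>" using \<xi> by auto
    let ?s = "1 / (b * \<xi>)"
    have s: "0 < ?s" "?s < 1 / b" using inverse_range[OF 1(1)] inverse_less[of 1 \<xi>] \<xi> by auto
    have I: "((\<lambda>u. ln (radius u)) has_integral ?s * L_tilde x b \<xi>) {0..?s}"
      using assms 1 beta_tilde_mono[of \<zeta> \<xi>] by (intro rescaled.L_tilde_constant rescaled) auto
    have "ln (radius ?s) * (?s - 0) \<le> ?s * L_tilde x b \<xi>"
      using s arc_radius_pos by (intro has_integral_ge_const[OF I]) (auto intro!: arc_radius_antimono)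
    moreover have "- ln (sin (pi * (1 / 2) / b)) * (?s - 0) \<le> - (?s * L_tilde x b \<xi>)"
    proof (rule has_integral_ge_const[OF has_integral_neg[OF I]])
      fix u assume "0 \<le> u" "u < ?s"
      then have "ln (radius u) \<le> ln (sin (pi * (1 / 2) / b))"
        using s arc_radius_pos[of u] radius_le_endpoint[of u] by (intro ln_mono) auto
      then show "- ln (sin (pi * (1 / 2) / b)) \<le> - ln (radius u)" by simp
    qed (use s in auto)
    ultimately have "?s * ln (radius ?s) \<le> ?s * L_tilde x b \<xi>" "?s * L_tilde x b \<xi> \<le> ?s * ln (sin (pi * (1 / 2) / b))"
      by (simp_all only: mult.commute diff_zero mult_minus_left mult_minus_right neg_le_iff_le)
    then show ?thesis using s(1) by (simp only: mult_le_cancel_left_pos)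
  qed
  show "\<forall>\<^sub>F \<xi> in at_top. ln (radius (1 / (b * \<xi>))) \<le> L_tilde x b \<xi>"
    using eventually_ge_at_top[of "max \<zeta> 2"] by eventually_elim (use both in blast)
  show "\<forall>\<^sub>F \<xi> in at_top. L_tilde x b \<xi> \<le> ln (sin (pi * (1 / 2) / b))"
    using eventually_ge_at_top[of "max \<zeta> 2"] by eventually_elim (use both in blast)
qed simp

end

section \<open>The sign of the potential\<close>

context proper_scale
begin

lemma potential_endpoint:
  assumes "0 \<le> u" "u \<le> 1 / b"
  shows "potential (1 / 2) u = ln (sin (pi / (2 * b) + pi * u / 2) / cos (pi * u / 2))"
proof -
  define S C t where "S = sin (pi / (2 * b))" and "C = cos (pi / (2 * b))" and "t = tan (pi * u / 2)"
  have c: "0 < cos (pi * u / 2)" "0 \<le> C" using cos_angle[OF assms] by (simp_all add: C_def mult.commute)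
  have t: "0 \<le> t"
    unfolding t_def tan_def using c half_angle_bounds[OF assms] by (intro divide_nonneg_nonneg sin_ge_zero) auto
  have S: "sin (pi * (1 / 2) / b) = S" by (simp add: S_def)
  have "S\<^sup>2 - (radius u)\<^sup>2 = (C / cos (pi * u / 2))\<^sup>2 - C\<^sup>2"
    unfolding arc_radius_square[OF assms] by (simp add: S_def C_def sin_squared_eq mult.commute)
  also have "\<dots> = (C * t)\<^sup>2"
    using c(1) by (simp add: t_def tan_def power_divide power_mult_distrib sin_squared_eq field_simps)
  finally have sq: "sqrt (S\<^sup>2 - (radius u)\<^sup>2) = C * t" using c t by simp
  have "potential (1 / 2) u = ln (S + C * t)"
    using radius_le_endpoint[OF assms] arc_radius_bounds[OF assms] sin_endpoint(1)
    unfolding S by (subst arc_potential_outside) (auto simp: sq)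
  also have "S + C * t = sin (pi / (2 * b) + pi * u / 2) / cos (pi * u / 2)"
    unfolding S_def C_def t_def tan_def sin_add using c(1) by (simp add: field_simps)
  finally show ?thesis .
qed

text \<open>For \<open>\<xi> = 1\<close> the measure is uniform.  The product of the arguments of the logarithm at \<open>u\<close> and
\<open>1 / b - u\<close> is \<open>1 - cos (pi / b) cos (pi / (2 b)) / (cos (pi u / 2) cos (pi (1 / b - u) / 2))\<close>, so that
the sign of the integral is decided by \<open>cos (pi / b)\<close>.\<close>

lemma L_tilde_uniform_negative:
  assumes "2 < b"
  shows "L_tilde (1 / 2) b 1 < 0"
proof -
  define \<gamma> where "\<gamma> = pi / (2 * b)"
  define \<kappa> where "\<kappa> = cos (2 * \<gamma>) * cos \<gamma>"
  define I where "I = 1 / b * L_tilde (1 / 2) b 1"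
  have \<gamma>: "0 < \<gamma>" "\<gamma> < pi / 4" using assms by (auto simp: \<gamma>_def field_simps)
  then have \<kappa>: "0 < \<kappa>" unfolding \<kappa>_def by (intro mult_pos_pos cos_gt_zero) auto
  have pair: "\<kappa> \<le> - (potential (1 / 2) u + potential (1 / 2) (1 / b - u))" if u: "0 \<le> u" "u \<le> 1 / b" for u
  proof -
    define x z where "x = pi * u / 2" and "z = pi * (1 / b - u) / 2"
    have xz: "x + z = \<gamma>" by (simp add: x_def z_def \<gamma>_def field_simps)
    have u': "0 \<le> 1 / b - u" "1 / b - u \<le> 1 / b" using u by auto
    have c: "0 < cos x" "0 < cos z" unfolding x_def z_def using cos_angle(1) u u' by auto
    have nonneg: "0 \<le> x" "0 \<le> z" using u by (auto simp: x_def z_def)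
    have s: "0 < sin (\<gamma> + x)" "0 < sin (\<gamma> + z)" using nonneg xz \<gamma> by (auto intro!: sin_gt_zero)
    have "sin (\<gamma> + x) * sin (\<gamma> + z) = (cos (x - z) - cos (3 * \<gamma>)) / 2"
    proof -
      have "\<gamma> + x - (\<gamma> + z) = x - z" "\<gamma> + x + (\<gamma> + z) = 3 * \<gamma>" using xz by auto
      then show ?thesis by (simp add: sin_times_sin)
    qed
    moreover have "cos x * cos z = (cos (x - z) + cos \<gamma>) / 2" by (simp add: cos_times_cos xz)
    moreover have "\<kappa> = (cos \<gamma> + cos (3 * \<gamma>)) / 2" by (simp add: \<kappa>_def cos_times_cos)
    ultimately have prod: "sin (\<gamma> + x) * sin (\<gamma> + z) = cos x * cos z - \<kappa>" by (simp add: field_simps)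
    have "potential (1 / 2) u + potential (1 / 2) (1 / b - u) =
        ln (sin (\<gamma> + x) / cos x) + ln (sin (\<gamma> + z) / cos z)"
      unfolding potential_endpoint[OF u] potential_endpoint[OF u'] \<gamma>_def x_def z_def ..
    also have "\<dots> = ln ((sin (\<gamma> + x) / cos x) * (sin (\<gamma> + z) / cos z))"
      using c s by (intro ln_mult_pos[symmetric]) auto
    also have "\<dots> \<le> (sin (\<gamma> + x) / cos x) * (sin (\<gamma> + z) / cos z) - 1"
      using c s by (intro ln_le_minus_one mult_pos_pos divide_pos_pos)
    also have "\<dots> = sin (\<gamma> + x) * sin (\<gamma> + z) / (cos x * cos z) - 1" by simp
    also have "\<dots> = - (\<kappa> / (cos x * cos z))"
      unfolding prod using c by (simp add: diff_divide_distrib)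
    also have "\<dots> \<le> - \<kappa>"
    proof -
      have "cos x * cos z \<le> 1" using c by (intro mult_le_one) auto
      then have "\<kappa> / 1 \<le> \<kappa> / (cos x * cos z)" using \<kappa> c by (intro divide_left_mono mult_pos_pos) auto
      then show ?thesis by simp
    qed
    finally show ?thesis by simp
  qed
  have I: "(potential (1 / 2) has_integral I) {0..1 / b}"
    using rescaled.has_integral_L_tilde[OF rescaled[of 1], of "1 / 2"] by (simp add: I_def)
  then have "((\<lambda>u. potential (1 / 2) (- u)) has_integral I) {- (1 / b)..- 0}"
    by (subst has_integral_reflect_real)
  from has_integral_shift_real_ivl[OF this, of "- (1 / b)"]
  have "((\<lambda>u. potential (1 / 2) (1 / b - u)) has_integral I) {0..1 / b}" by simp
  from has_integral_neg[OF has_integral_add[OF I this]]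
  have "\<kappa> * (1 / b - 0) \<le> - (I + I)"
    by (rule has_integral_ge_const) (use b pair in auto)
  moreover have "0 < \<kappa> * (1 / b - 0)" using \<kappa> b by simp
  ultimately have "I < 0" by linarith
  then show ?thesis using b by (simp add: I_def divide_less_0_iff)
qed

lemma L_tilde_endpoint_eventually_negative: "\<exists>\<xi>\<ge>1. L_tilde (1 / 2) b \<xi> < 0"
proof -
  have "potential (1 / 2) 0 = ln (sin (pi * (1 / 2) / b))"
    using sin_endpoint by (subst arc_potential_inside) auto
  then have "potential (1 / 2) 0 < 0" using sin_endpoint by simp
  moreover have "isCont (potential (1 / 2)) 0"
    using sin_endpoint b by (intro isCont_arc_potential_radius) (auto simp: less_max_iff_disj)
  from isCont_tendsto_compose[OF this inverse_tendsto_0]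
  have "((\<lambda>\<xi>. potential (1 / 2) (1 / (b * \<xi>))) \<longlongrightarrow> potential (1 / 2) 0) at_top" .
  ultimately have "\<forall>\<^sub>F \<xi> in at_top. potential (1 / 2) (1 / (b * \<xi>)) < 0" by (intro order_tendstoD(2))
  with eventually_ge_at_top[of 1] have "\<forall>\<^sub>F \<xi> in at_top. 1 \<le> \<xi> \<and> L_tilde (1 / 2) b \<xi> < 0"
  proof eventually_elim
    case (elim \<xi>)
    then show ?case using L_tilde_endpoint_less[of \<xi>] by simp
  qed
  then show ?thesis by (auto simp: eventually_at_top_linorder)
qed

lemma L_tilde_positive_near_endpoint:
  assumes "1 \<le> \<xi>" "0 < L_tilde (1 / 2) b \<xi>"
  shows "\<exists>x\<in>{0<..<1 / 2}. 0 < L_tilde x b \<xi>"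
proof -
  define y where "y = (\<lambda>x. sin (pi * x / b))"
  define \<eta> where "\<eta> = (\<lambda>x. - (((y (1 / 2) - y x) + sqrt ((y (1 / 2))\<^sup>2 - (y x)\<^sup>2)) / y x))"
  have y0: "0 < y (1 / 2)" unfolding y_def by (rule sin_endpoint(1))
  have cont: "isCont y (1 / 2)" unfolding y_def by (rule isCont_sin_scale)
  then have "isCont \<eta> (1 / 2)" unfolding \<eta>_def using y0 by (intro continuous_intros) auto
  moreover have "- L_tilde (1 / 2) b \<xi> < \<eta> (1 / 2)" using assms by (simp add: \<eta>_def)
  ultimately have "\<forall>\<^sub>F x in nhds (1 / 2). - L_tilde (1 / 2) b \<xi> < \<eta> x" by (rule eventually_less_isCont)
  then obtain d where d: "0 < d" "\<And>x. dist x (1 / 2) < d \<Longrightarrow> - L_tilde (1 / 2) b \<xi> < \<eta> x"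
    by (auto simp: eventually_nhds_metric)
  define x where "x = max (1 / 4) (1 / 2 - d / 2)"
  have x: "0 < x" "x < 1 / 2" "dist x (1 / 2) < d" using d(1) by (auto simp: x_def dist_real_def max_def)
  have "0 < pi * x / b" "pi * x / b < pi" using x b by (auto simp: field_simps intro: less_trans[of _ 1])
  then have yx: "0 < y x" unfolding y_def by (intro sin_gt_zero)
  have "\<bar>y x\<bar> \<le> \<bar>y (1 / 2)\<bar>" unfolding y_def using x b by (intro sin_scale(1)) auto
  then have yle: "y x \<le> y (1 / 2)" using yx y0 by simp
  let ?s = "1 / (b * \<xi>)"
  have s: "0 < ?s" by (rule inverse_range(1)[OF assms(1)])
  have "((\<lambda>u. potential x u - potential (1 / 2) u) has_integral ?s * L_tilde x b \<xi> - ?s * L_tilde (1 / 2) b \<xi>) {0..?s}"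
    by (intro has_integral_diff rescaled.has_integral_L_tilde rescaled assms)
  then have "\<eta> x * (?s - 0) \<le> ?s * L_tilde x b \<xi> - ?s * L_tilde (1 / 2) b \<xi>"
  proof (rule has_integral_ge_const)
    fix u
    show "\<eta> x \<le> potential x u - potential (1 / 2) u"
      using arc_potential_diff_le[OF yx yle, of "radius u"] unfolding \<eta>_def y_def by linarith
  qed (use s in simp)
  then have "?s * \<eta> x \<le> ?s * (L_tilde x b \<xi> - L_tilde (1 / 2) b \<xi>)" by (simp only: right_diff_distrib mult.commute diff_zero)
  then have "\<eta> x \<le> L_tilde x b \<xi> - L_tilde (1 / 2) b \<xi>" using s by (simp only: mult_le_cancel_left_pos)
  with d(2)[OF x(3)] have "0 < L_tilde x b \<xi>" by linarith
  with x show ?thesis by auto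
qed

text \<open>The threshold is the supremum of the parameters at which the value at the endpoint is nonnegative,
or \<open>1\<close> if there are none.\<close>

lemma sign_threshold:
  "\<exists>\<xi>\<^sub>b\<ge>1. (\<forall>\<xi>>\<xi>\<^sub>b. \<forall>x\<in>{-1/2..1/2}. L_tilde x b \<xi> < 0) \<and>
    (\<forall>\<xi>. 1 \<le> \<xi> \<and> \<xi> < \<xi>\<^sub>b \<longrightarrow>
      (\<exists>x\<^sub>\<xi>\<in>{0<..<1/2}. \<forall>x\<in>{-1/2..<-x\<^sub>\<xi>} \<union> {x\<^sub>\<xi><..1/2}. L_tilde x b \<xi> > 0))"
proof -
  define S where "S = insert 1 {\<xi>. 1 \<le> \<xi> \<and> 0 \<le> L_tilde (1 / 2) b \<xi>}"
  obtain \<zeta> where \<zeta>: "1 \<le> \<zeta>" "L_tilde (1 / 2) b \<zeta> < 0" using L_tilde_endpoint_eventually_negative by blast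
  have bound: "\<xi> \<le> \<zeta>" if "\<xi> \<in> S" for \<xi>
  proof (rule ccontr)
    assume "\<not> \<xi> \<le> \<zeta>"
    then show False using that \<zeta> L_tilde_endpoint_decreasing[of \<zeta> \<xi>] by (auto simp: S_def)
  qed
  then have bdd: "bdd_above S" by (rule bdd_aboveI)
  have one: "1 \<in> S" by (simp add: S_def)
  have "1 \<le> Sup S" using one bdd by (rule cSup_upper)
  moreover have "L_tilde x b \<xi> < 0" if "Sup S < \<xi>" "x \<in> {-1/2..1/2}" for \<xi> x
  proof -
    have \<xi>: "1 \<le> \<xi>" using \<open>1 \<le> Sup S\<close> that by simp
    have "\<xi> \<notin> S" using that cSup_upper[OF _ bdd, of \<xi>] by auto
    then have "L_tilde (1 / 2) b \<xi> < 0" using \<xi> by (auto simp: S_def)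
    moreover have "L_tilde x b \<xi> \<le> L_tilde (1 / 2) b \<xi>"
      using that by (intro rescaled.L_tilde_mono rescaled \<xi>) auto
    ultimately show ?thesis by simp
  qed
  moreover have "\<exists>x\<^sub>\<xi>\<in>{0<..<1/2}. \<forall>x\<in>{-1/2..<-x\<^sub>\<xi>} \<union> {x\<^sub>\<xi><..1/2}. L_tilde x b \<xi> > 0"
    if \<xi>: "1 \<le> \<xi>" "\<xi> < Sup S" for \<xi>
  proof -
    obtain \<omega> where "\<omega> \<in> S" "\<xi> < \<omega>" using less_cSupE[OF \<xi>(2)] one by blast
    then have "0 \<le> L_tilde (1 / 2) b \<omega>" "L_tilde (1 / 2) b \<omega> < L_tilde (1 / 2) b \<xi>"
      using \<xi> L_tilde_endpoint_decreasing[of \<xi> \<omega>] by (auto simp: S_def)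
    then have "0 < L_tilde (1 / 2) b \<xi>" by simp
    then obtain z where z: "z \<in> {0<..<1 / 2}" "0 < L_tilde z b \<xi>"
      using L_tilde_positive_near_endpoint \<xi> by blast
    have "0 < L_tilde x b \<xi>" if "x \<in> {-1/2..<-z} \<union> {z<..1/2}" for x
    proof -
      have "L_tilde z b \<xi> \<le> L_tilde x b \<xi>"
        using that z by (intro rescaled.L_tilde_mono rescaled \<xi>) auto
      with z show ?thesis by simp
    qed
    with z show ?thesis by blast
  qed
  ultimately show ?thesis by blast
qed

end

theorem proposition1p2:
  shows
   "(\<forall>b::real. \<forall>\<xi>::real. 1 \<le> b \<and> 1 \<le> \<xi> \<and> (b, \<xi>) \<noteq> (1, 1) \<longrightarrow>
       (\<lambda>x. L_tilde x b \<xi>) constant_on {- beta_tilde b \<xi>..beta_tilde b \<xi>} \<and>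
       strict_mono_on {beta_tilde b \<xi>..1/2} (\<lambda>x. L_tilde x b \<xi>) \<and>
       strict_antimono_on {-1/2..- beta_tilde b \<xi>} (\<lambda>x. L_tilde x b \<xi>))
    \<and>
    (\<forall>b::real. 1 < b \<longrightarrow>
       strict_antimono_on {1<..} (\<lambda>\<xi>. L_tilde (1/2) b \<xi>) \<and>
       strict_antimono_on {1<..} (\<lambda>\<xi>. L_tilde (-1/2) b \<xi>) \<and>
       (\<forall>\<xi>\<^sub>0>1. \<exists>\<delta>>0. \<forall>x. 1/2 - \<delta> < \<bar>x\<bar> \<and> \<bar>x\<bar> \<le> 1/2 \<longrightarrow>
          (\<exists>\<epsilon>>0. strict_antimono_on ({\<xi>\<^sub>0 - \<epsilon><..<\<xi>\<^sub>0 + \<epsilon>} \<inter> {1<..}) (\<lambda>\<xi>. L_tilde x b \<xi>))))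
    \<and>
    (\<forall>b::real. 1 < b \<longrightarrow>
       (\<forall>x. strict_mono_on {\<xi>. 1 \<le> \<xi> \<and> \<bar>x\<bar> \<le> beta_tilde b \<xi>} (\<lambda>\<xi>. L_tilde x b \<xi>)) \<and>
       (beta_tilde b \<longlongrightarrow> 1/2) at_top \<and>
       (\<exists>c<0. \<forall>x. (\<exists>\<xi>\<ge>1. \<bar>x\<bar> \<le> beta_tilde b \<xi>) \<longrightarrow> ((\<lambda>\<xi>. L_tilde x b \<xi>) \<longlongrightarrow> c) at_top))
    \<and>
    (\<forall>b::real. 2 < b \<longrightarrow>
       (\<forall>\<xi>\<ge>1. \<forall>x\<in>{-1/2..1/2}. L_tilde x b \<xi> < 0))
    \<and>
    (\<forall>b::real. 1 < b \<and> b \<le> 2 \<longrightarrow>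
       (\<exists>\<xi>\<^sub>b\<ge>1.
          (\<forall>\<xi>>\<xi>\<^sub>b. \<forall>x\<in>{-1/2..1/2}. L_tilde x b \<xi> < 0) \<and>
          (\<forall>\<xi>. 1 \<le> \<xi> \<and> \<xi> < \<xi>\<^sub>b \<longrightarrow>
             (\<exists>x\<^sub>\<xi>\<in>{0<..<1/2}. \<forall>x\<in>{-1/2..<-x\<^sub>\<xi>} \<union> {x\<^sub>\<xi><..1/2}. L_tilde x b \<xi> > 0))))"
proof (intro conjI allI impI)
  fix b \<xi> :: real
  assume "1 \<le> b \<and> 1 \<le> \<xi> \<and> (b, \<xi>) \<noteq> (1, 1)"
  then interpret rescaled b \<xi> by unfold_locales auto
  have "L_tilde x b \<xi> = L_tilde 0 b \<xi>" if "x \<in> {- beta_tilde b \<xi>..beta_tilde b \<xi>}" for x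
  proof -
    have "1 / (b * \<xi>) * L_tilde x b \<xi> = 1 / (b * \<xi>) * L_tilde 0 b \<xi>"
      using that beta_tilde_bounds by (intro has_integral_unique[OF L_tilde_constant L_tilde_constant]) auto
    then show ?thesis using b xi by simp
  qed
  then show "(\<lambda>x. L_tilde x b \<xi>) constant_on {- beta_tilde b \<xi>..beta_tilde b \<xi>}"
    unfolding constant_on_def by blast
  show "strict_mono_on {beta_tilde b \<xi>..1/2} (\<lambda>x. L_tilde x b \<xi>)"
    by (intro monotone_onI L_tilde_strict_mono) auto
  show "strict_antimono_on {-1/2..- beta_tilde b \<xi>} (\<lambda>x. L_tilde x b \<xi>)"
  proof (rule monotone_onI)
    fix x z assume "x \<in> {-1/2..- beta_tilde b \<xi>}" "z \<in> {-1/2..- beta_tilde b \<xi>}" "x < z"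
    then have "L_tilde (- z) b \<xi> < L_tilde (- x) b \<xi>" by (intro L_tilde_strict_mono) auto
    then show "L_tilde z b \<xi> < L_tilde x b \<xi>" by (simp add: L_tilde_minus)
  qed
next
  fix b :: real
  assume "1 < b"
  then interpret proper_scale b by unfold_locales
  show anti: "strict_antimono_on {1<..} (\<lambda>\<xi>. L_tilde (1/2) b \<xi>)"
    by (intro monotone_onI L_tilde_endpoint_decreasing) auto
  have "L_tilde (- 1 / 2) b \<xi> = L_tilde (1 / 2) b \<xi>" if "1 < \<xi>" for \<xi>
    using rescaled.L_tilde_minus[OF rescaled, of \<xi> "1 / 2"] that by simp
  then show "strict_antimono_on {1<..} (\<lambda>\<xi>. L_tilde (-1/2) b \<xi>)"
    using anti by (auto simp: monotone_on_def)
  show "\<exists>\<delta>>0. \<forall>x. 1/2 - \<delta> < \<bar>x\<bar> \<and> \<bar>x\<bar> \<le> 1/2 \<longrightarrow>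
      (\<exists>\<epsilon>>0. strict_antimono_on ({\<xi>\<^sub>0 - \<epsilon><..<\<xi>\<^sub>0 + \<epsilon>} \<inter> {1<..}) (\<lambda>\<xi>. L_tilde x b \<xi>))" if "1 < \<xi>\<^sub>0" for \<xi>\<^sub>0
    by (rule L_tilde_near_endpoint_decreasing[OF that])
next
  fix b :: real
  assume "1 < b"
  then interpret proper_scale b by unfold_locales
  show "strict_mono_on {\<xi>. 1 \<le> \<xi> \<and> \<bar>x\<bar> \<le> beta_tilde b \<xi>} (\<lambda>\<xi>. L_tilde x b \<xi>)" for x
    by (intro monotone_onI L_tilde_inside_increasing) auto
  show "(beta_tilde b \<longlongrightarrow> 1/2) at_top" by (rule tendsto_beta_tilde)
  show "\<exists>c<0. \<forall>x. (\<exists>\<xi>\<ge>1. \<bar>x\<bar> \<le> beta_tilde b \<xi>) \<longrightarrow> ((\<lambda>\<xi>. L_tilde x b \<xi>) \<longlongrightarrow> c) at_top"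
  proof (intro exI conjI allI impI)
    show "ln (sin (pi * (1 / 2) / b)) < 0" using sin_endpoint by simp
    show "((\<lambda>\<xi>. L_tilde x b \<xi>) \<longlongrightarrow> ln (sin (pi * (1 / 2) / b))) at_top"
      if "\<exists>\<xi>\<ge>1. \<bar>x\<bar> \<le> beta_tilde b \<xi>" for x
      using that tendsto_L_tilde_inside by blast
  qed
next
  fix b :: real
  assume "2 < b"
  then interpret proper_scale b by unfold_locales simp
  show "\<forall>x\<in>{-1/2..1/2}. L_tilde x b \<xi> < 0" if "1 \<le> \<xi>" for \<xi>
  proof
    fix x :: real assume "x \<in> {-1/2..1/2}"
    then have "L_tilde x b \<xi> \<le> L_tilde (1 / 2) b \<xi>" by (intro rescaled.L_tilde_mono rescaled that) auto
    also have "\<dots> \<le> L_tilde (1 / 2) b 1"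
      using L_tilde_endpoint_decreasing[of 1 \<xi>] that by (cases "\<xi> = 1") auto
    also have "\<dots> < 0" by (rule L_tilde_uniform_negative[OF \<open>2 < b\<close>])
    finally show "L_tilde x b \<xi> < 0" .
  qed
next
  fix b :: real
  assume "1 < b \<and> b \<le> 2"
  then interpret proper_scale b by unfold_locales simp
  show "\<exists>\<xi>\<^sub>b\<ge>1. (\<forall>\<xi>>\<xi>\<^sub>b. \<forall>x\<in>{-1/2..1/2}. L_tilde x b \<xi> < 0) \<and>
      (\<forall>\<xi>. 1 \<le> \<xi> \<and> \<xi> < \<xi>\<^sub>b \<longrightarrow>
        (\<exists>x\<^sub>\<xi>\<in>{0<..<1/2}. \<forall>x\<in>{-1/2..<-x\<^sub>\<xi>} \<union> {x\<^sub>\<xi><..1/2}. L_tilde x b \<xi> > 0))"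
    by (rule sign_threshold)
qed

end
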